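(* For every integer $m\ge12$, $$z_2(m,5)=z_{\mathrm{RL}}(m,5)=3m+5 .$$ Every extremal configuration for $z_{\mathrm{RL}}(m,5)$ with $m\ge 12$ (i.e. every simple limited configuration on the $m\times5$ grid satisfying $(\mathrm{RW3}^+)$ with $|E_1|+|E_2|=z_{\mathrm{RL}}(m,5)$) has no holes, i.e. $H=0$. In particular, $z_{\mathrm{RL}}(m+1,5)=z_{\mathrm{RL}}(m,5)+3$ for all $m\ge12$.
   Context: **Augmented configurations.** Cells of the $m\times5$ grid are pairs $(r,c)$, $1\le r\le m$, $1\le c\le5$. An augmented configuration consists of a set $E_1$ of cells (one-edges) and a set $E_2$ of unordered pairs of distinct cells (selected two-edges; the two cells are the halves of the two-edge). Each cell contains at most one edge element, i.e. it is a one-edge, or one half of exactly one selected two-edge, or unoccupied (a hole); in particular supports of distinct edge elements are disjoint. $H$ is the number of unoccupied cells. The configuration is simple if it satisfies this disjointness and the one-edge graph (the bipartite graph between rows and columns with edge set $E_1$) is $C_4$-free, i.e. there are no distinct rows $r,s$ and distinct columns $c,d$ with all four cells $(r,c),(r,d),(s,c),(s,d)$ in $E_1$. It is limited if $|E_1|=z(m,5)$, where $z(m,5)$ is the ordinary Zarankiewicz number (maximum number of edges of a $C_4$-free bipartite graph with parts of sizes $m$ and $5$); $z(m,5)=m+10$ for $m\ge10$. The edge elements (labels) are the one-edges and the selected two-edges. The cells of an edge element are its representatives. **Certificates.** To each occupied cell $p$ associate a formal unit vector $v_p$, and put $v_p=0$ for unoccupied $p$. For distinct cells $p,q$ let $\delta(p,q)=1$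 if $\{p,q\}\in E_2$ and $\delta(p,q)=0$ otherwise. The certified relations are the statements $\langle v_p,v_q\rangle=\text{(value)}$ (symmetric in $p,q$) obtainable in finitely many steps by: - Unit/hole: $\langle v_p,v_p\rangle=1$ for occupied $p$; $\langle v_p,v_q\rangle=0$ if $p$ or $q$ is unoccupied. - Line rule: if $p\ne q$ lie in a common row or a common column, then $\langle v_p,v_q\rangle=\delta(p,q)$. - Rectangle rule: for distinct rows and distinct columns forming a genuine $2\times2$ rectangle with diagonals $\{p,q\}$ and $\{r,s\}$, one has $\langle v_p,v_q\rangle+\langle v_r,v_s\rangle=\delta(p,q)+\delta(r,s)$; so if the value of one diagonal is certified, the value of the other one given by this identity is certified. - Complementary-pair rule: if both diagonals of a genuine rectangle are selected two-edges, then both diagonals are certified to have value $1$. - Saturation: if $\langle v_p,v_{p'}\rangle=1$ is certified, then $p$ and $p'$ may be interchanged in any certified relation. Write $p\sim q$ if $\langle v_p,v_q\rangle=1$ is certified and $p\perp_R q$ if $\langle v_p,v_q\rangle=0$ is certified. **$(\mathrm{RW3}^+)$.** A simple configuration satisfies $(\mathrm{RW3}^+)$ if: (1) $p\sim q$ for every $\{p,q\}\in E_2$; (2) distinct selected two-edges remain in distinct equivalence classes of $\sim$; (3) any two distinct edge elements have certified orthogonal representatives (some cell of one and some cell of the other, hence after (1) all of them, satisfy $\perp_R$). **$z_{\mathrm{RL}}$.** $z_{\mathrm{RL}}(m,5)$ is the maximum of $|E_1|+|E_2|$ over all simple limited configurations on the $m\times5$ grid satisfying $(\mathrm{RW3}^+)$.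 **$z_2$.** To a configuration $G=(E_1,E_2)$ associate the biquadratic form $$P_G(x,y)=\sum_{(r,c)\in E_1}x_r^2y_c^2+\sum_{\{(r,c),(s,d)\}\in E_2}(x_ry_c+x_sy_d)^2,\qquad x\in\mathbb R^m,\ y\in\mathbb R^5 .$$ Its SOS rank is the least number of bilinear forms (real coefficients) whose squares sum to $P_G$; $P_G$ is called irreducible if its SOS rank equals $|E_1|+|E_2|$. The second order Zarankiewicz number $z_2(m,5)$ is the maximum of $|E_1|+|E_2|$ over all simple limited configurations $G$ on the $m\times5$ grid for which $P_G$ is irreducible. (The known hierarchy is $z_2(m,5)\ge z_{\mathrm{RL}}(m,5)$.) *)

theory Defs
  imports Complex_Main
begin

type_synonym cell = "nat \<times> nat"

definition grid :: "nat \<Rightarrow> nat \<Rightarrow> cell set" where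
  "grid m n = {1..m} \<times> {1..n}"


subsection \<open>Augmented configurations\<close>

text \<open>A bipartite graph with parts of sizes m and n is identified with a set of cells of the
  m by n grid.\<close>

definition C4_free :: "cell set \<Rightarrow> bool" where
  "C4_free E \<longleftrightarrow>
     \<not> (\<exists>r s c d. r \<noteq> s \<and> c \<noteq> d \<and> (r, c) \<in> E \<and> (r, d) \<in> E \<and> (s, c) \<in> E \<and> (s, d) \<in> E)"

definition zarankiewicz :: "nat \<Rightarrow> nat \<Rightarrow> nat" where
  "zarankiewicz m n = Max {card E | E. E \<subseteq> grid m n \<and> C4_free E}"

text \<open>A configuration is given by its set E1 of one-edges (cells) and its set E2 of selected
  two-edges, an unordered pair of distinct cells being a two-element set of cells.\<close>

definition configuration :: "nat \<Rightarrow> nat \<Rightarrow> cell set \<Rightarrow> cell set set \<Rightarrow> bool" where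
  "configuration m n E1 E2 \<longleftrightarrow>
     E1 \<subseteq> grid m n \<and> (\<forall>e\<in>E2. e \<subseteq> grid m n \<and> card e = 2)"

definition edge_elements :: "cell set \<Rightarrow> cell set set \<Rightarrow> cell set set" where
  "edge_elements E1 E2 = {{p} | p. p \<in> E1} \<union> E2"

definition occupied :: "cell set \<Rightarrow> cell set set \<Rightarrow> cell set" where
  "occupied E1 E2 = E1 \<union> \<Union>E2"

definition holes :: "nat \<Rightarrow> nat \<Rightarrow> cell set \<Rightarrow> cell set set \<Rightarrow> nat" where
  "holes m n E1 E2 = card (grid m n - occupied E1 E2)"

definition simple_config :: "nat \<Rightarrow> nat \<Rightarrow> cell set \<Rightarrow> cell set set \<Rightarrow> bool" where
  "simple_config m n E1 E2 \<longleftrightarrow>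
     configuration m n E1 E2 \<and>
     (\<forall>a\<in>edge_elements E1 E2. \<forall>b\<in>edge_elements E1 E2. a \<noteq> b \<longrightarrow> a \<inter> b = {}) \<and>
     C4_free E1"

definition limited :: "nat \<Rightarrow> nat \<Rightarrow> cell set \<Rightarrow> bool" where
  "limited m n E1 \<longleftrightarrow> card E1 = zarankiewicz m n"


subsection \<open>Certified relations\<close>

definition delta :: "cell set set \<Rightarrow> cell \<Rightarrow> cell \<Rightarrow> real" where
  "delta E2 p q = (if {p, q} \<in> E2 then 1 else 0)"

text \<open>The vectors are formal: \<open>certified m n E1 E2 p q a\<close> says that the statement
  \<open>\<langle>v\<^sub>p, v\<^sub>q\<rangle> = a\<close> is derivable.\<close>

inductive certified ::
  "nat \<Rightarrow> nat \<Rightarrow> cell set \<Rightarrow> cell set set \<Rightarrow> cell \<Rightarrow> cell \<Rightarrow> real \<Rightarrow> bool"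
  for m n :: nat and E1 :: "cell set" and E2 :: "cell set set" where
  sym: "certified m n E1 E2 p q a \<Longrightarrow> certified m n E1 E2 q p a"
| unit: "p \<in> grid m n \<Longrightarrow> p \<in> occupied E1 E2 \<Longrightarrow> certified m n E1 E2 p p 1"
| hole: "p \<in> grid m n \<Longrightarrow> q \<in> grid m n \<Longrightarrow> p \<notin> occupied E1 E2 \<or> q \<notin> occupied E1 E2 \<Longrightarrow>
    certified m n E1 E2 p q 0"
| line: "p \<in> grid m n \<Longrightarrow> q \<in> grid m n \<Longrightarrow> p \<noteq> q \<Longrightarrow> fst p = fst q \<or> snd p = snd q \<Longrightarrow>
    certified m n E1 E2 p q (delta E2 p q)"
| rectangle: "r \<in> {1..m} \<Longrightarrow> s \<in> {1..m} \<Longrightarrow> r \<noteq> s \<Longrightarrow> c \<in> {1..n} \<Longrightarrow> d \<in> {1..n} \<Longrightarrow> c \<noteq> d \<Longrightarrow>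
    certified m n E1 E2 (r, c) (s, d) a \<Longrightarrow>
    certified m n E1 E2 (r, d) (s, c) (delta E2 (r, c) (s, d) + delta E2 (r, d) (s, c) - a)"
| complementary: "r \<in> {1..m} \<Longrightarrow> s \<in> {1..m} \<Longrightarrow> r \<noteq> s \<Longrightarrow> c \<in> {1..n} \<Longrightarrow> d \<in> {1..n} \<Longrightarrow> c \<noteq> d \<Longrightarrow>
    {(r, c), (s, d)} \<in> E2 \<Longrightarrow> {(r, d), (s, c)} \<in> E2 \<Longrightarrow>
    certified m n E1 E2 (r, c) (s, d) 1"
| saturation: "certified m n E1 E2 p p' 1 \<Longrightarrow> certified m n E1 E2 p q a \<Longrightarrow>
    certified m n E1 E2 p' q a"

text \<open>In \<open>complementary\<close>, the other diagonal is obtained by exchanging c and d; in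
  \<open>saturation\<close>, the second argument and the converse replacement are covered by \<open>sym\<close>.\<close>

definition sim_rel :: "nat \<Rightarrow> nat \<Rightarrow> cell set \<Rightarrow> cell set set \<Rightarrow> (cell \<times> cell) set" where
  "sim_rel m n E1 E2 = {(p, q). certified m n E1 E2 p q 1}"

definition perp_rel :: "nat \<Rightarrow> nat \<Rightarrow> cell set \<Rightarrow> cell set set \<Rightarrow> (cell \<times> cell) set" where
  "perp_rel m n E1 E2 = {(p, q). certified m n E1 E2 p q 0}"

definition RW3plus :: "nat \<Rightarrow> nat \<Rightarrow> cell set \<Rightarrow> cell set set \<Rightarrow> bool" where
  "RW3plus m n E1 E2 \<longleftrightarrow>
     (\<forall>p q. {p, q} \<in> E2 \<longrightarrow> (p, q) \<in> sim_rel m n E1 E2) \<and>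
     (\<forall>e\<in>E2. \<forall>f\<in>E2. e \<noteq> f \<longrightarrow>
        (\<forall>p\<in>e. \<forall>q\<in>f. sim_rel m n E1 E2 `` {p} \<noteq> sim_rel m n E1 E2 `` {q})) \<and>
     (\<forall>a\<in>edge_elements E1 E2. \<forall>b\<in>edge_elements E1 E2. a \<noteq> b \<longrightarrow>
        (\<exists>p\<in>a. \<exists>q\<in>b. (p, q) \<in> perp_rel m n E1 E2))"

definition z_RL :: "nat \<Rightarrow> nat \<Rightarrow> nat" where
  "z_RL m n = Max {card E1 + card E2 | E1 E2.
     simple_config m n E1 E2 \<and> limited m n E1 \<and> RW3plus m n E1 E2}"


subsection \<open>Biquadratic forms and the second order Zarankiewicz number\<close>

text \<open>As the dimensions m and n are numbers, points of \<open>\<real>\<^sup>m\<close> are represented by functions on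
  the natural numbers of which only the values on \<open>{1..m}\<close> are used.\<close>

definition bilinear_form ::
  "nat \<Rightarrow> nat \<Rightarrow> (nat \<Rightarrow> nat \<Rightarrow> real) \<Rightarrow> (nat \<Rightarrow> real) \<Rightarrow> (nat \<Rightarrow> real) \<Rightarrow> real" where
  "bilinear_form m n b x y = (\<Sum>r = 1..m. \<Sum>c = 1..n. b r c * x r * y c)"

definition biquadratic_form ::
  "cell set \<Rightarrow> cell set set \<Rightarrow> (nat \<Rightarrow> real) \<Rightarrow> (nat \<Rightarrow> real) \<Rightarrow> real" where
  "biquadratic_form E1 E2 x y =
     (\<Sum>(r, c)\<in>E1. (x r)\<^sup>2 * (y c)\<^sup>2) + (\<Sum>e\<in>E2. (\<Sum>(r, c)\<in>e. x r * y c)\<^sup>2)"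

definition sos_rank ::
  "nat \<Rightarrow> nat \<Rightarrow> ((nat \<Rightarrow> real) \<Rightarrow> (nat \<Rightarrow> real) \<Rightarrow> real) \<Rightarrow> nat" where
  "sos_rank m n P = (LEAST k. \<exists>b :: nat \<Rightarrow> nat \<Rightarrow> nat \<Rightarrow> real.
     \<forall>x y. P x y = (\<Sum>i<k. (bilinear_form m n (b i) x y)\<^sup>2))"

definition irreducible_config :: "nat \<Rightarrow> nat \<Rightarrow> cell set \<Rightarrow> cell set set \<Rightarrow> bool" where
  "irreducible_config m n E1 E2 \<longleftrightarrow>
     sos_rank m n (biquadratic_form E1 E2) = card E1 + card E2"

definition z2 :: "nat \<Rightarrow> nat \<Rightarrow> nat" where
  "z2 m n = Max {card E1 + card E2 | E1 E2.
     simple_config m n E1 E2 \<and> limited m n E1 \<and> irreducible_config m n E1 E2}"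

end

theory Submission
  imports Defs
begin

text \<open>
  The upper bound is a count of cells. A limited configuration has \<open>z(m,5) = m + 10\<close> one-edges
  (\<open>C4_free_card_le\<close> gives the upper bound for \<open>z(m,5)\<close>, and the configurations below attain it), and each
  two-edge takes two of the other \<open>4 m - 10\<close> cells. This gives at most \<open>3 m + 5\<close> edge elements, for
  both numbers alike, with equality if and only if there are no holes (\<open>limited_config_count\<close>).

  It remains to exhibit, for each \<open>m \<ge> 12\<close>, a simple limited configuration without holes that
  satisfies \<open>(RW3\<^sup>+)\<close>. It then also counts for \<open>z\<^sub>2\<close>, because \<open>(RW3\<^sup>+)\<close> implies irreducibility
  (\<open>RW3plus_imp_irreducible\<close>): if the form is a sum of \<open>k\<close> squares of bilinear forms, the coefficients
  of these forms at a cell make up a vector in \<open>\<real>\<^sup>k\<close>, and comparison of coefficients shows that the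
  certified relations hold for these vectors (\<open>certified_gram\<close>). The edge elements thus yield
  orthonormal vectors in \<open>\<real>\<^sup>k\<close>, and there are at most \<open>k\<close> of them. The same soundness result, applied
  to the defining representation of the form, shows that each pair of cells has at most one value
  that can be certified. Hence \<open>(RW3\<^sup>+)\<close> follows as soon as all pairs of cells have some
  certified value (\<open>RW3plusI\<close>).

  The configurations are stacks of blocks of rows, where each two-edge stays within a block. The top
  block has 12 rows, ten of which carry two one-edges each; then follow at most three further rows,
  and the rest is filled by copies of a block with four rows. The rules derive the value for two
  cells from the rows of the blocks that contain them. So it is enough to have derivations for every
  single block and for every pair of blocks that occurs (\<open>RW3plus_layout\<close>), and this is a finite
  task, although the number of blocks is unbounded. In particular the block with four rows has to be
  compatible with a copy of itself. The derivations are given explicitly. With a two-edge identified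
  with each of its halves, the rectangle rule carries the value of a pair of cells to the pair on
  the other diagonal, so a derivation is a walk from the given pair to a pair on a common line,
  and only the choice of the halves has to be recorded (\<open>walk\<close>, \<open>walk_imp_linked\<close>).\<close>

section \<open>The Zarankiewicz number\<close>

lemma Max_attained:
  fixes S :: "nat set"
  assumes "k \<in> S" and "\<And>x. x \<in> S \<Longrightarrow> x \<le> k"
  shows "Max S = k"
  using assms by (intro Max_eqI) (auto intro: finite_subset[of S "{..k}"])

lemma finite_grid: "finite (grid m n)"
  by (simp add: grid_def)

text \<open>In a \<open>C\<^sub>4\<close>-free graph no pair of columns occurs in two rows. Hence, if row \<open>r\<close> has \<open>d\<^sub>r\<close> cells,
  the sum of the numbers \<open>d\<^sub>r choose 2\<close> is at most \<open>n choose 2\<close>, and \<open>d \<le> 1 + (d choose 2)\<close> for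
  every \<open>d\<close>. The bound is tight exactly when each row has one or two cells and each pair of
  columns is used, which is the shape of the one-edges of the configurations below.\<close>

lemma C4_free_card_le:
  assumes E: "E \<subseteq> grid m n" and C4: "C4_free E"
  shows "card E \<le> m + (n choose 2)"
proof -
  define D where "D r = {c. (r, c) \<in> E}" for r
  define P where "P r = {X. X \<subseteq> D r \<and> card X = 2}" for r
  have D_sub: "D r \<subseteq> {1..n}" for r
    using E by (auto simp: D_def grid_def)
  have finD: "finite (D r)" for r
    using D_sub finite_subset by blast
  have finP: "finite (P r)" for r
    unfolding P_def using finD by simp
  have "E = Sigma {1..m} D"
    using E by (auto simp: D_def grid_def)
  hence "card E = (\<Sum>r=1..m. card (D r))"
    using finD by (simp add: card_SigmaI)
  also have "\<dots> \<le> (\<Sum>r=1..m. 1 + card (P r))"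
  proof (rule sum_mono)
    fix r
    have "d \<le> 1 + (d choose 2)" for d :: nat
      by (induction d) (auto simp: numeral_2_eq_2)
    thus "card (D r) \<le> 1 + card (P r)"
      unfolding P_def n_subsets[OF finD] by blast
  qed
  also have "\<dots> = m + (\<Sum>r=1..m. card (P r))"
    by (simp only: sum.distrib) simp
  also have "(\<Sum>r=1..m. card (P r)) = card (\<Union>r\<in>{1..m}. P r)"
  proof (rule card_UN_disjoint[symmetric])
    show "\<forall>r\<in>{1..m}. \<forall>s\<in>{1..m}. r \<noteq> s \<longrightarrow> P r \<inter> P s = {}"
    proof (intro ballI impI equals0I)
      fix r s X assume rs: "r \<noteq> s" and X: "X \<in> P r \<inter> P s"
      then obtain c d where "X = {c, d}" "c \<noteq> d"
        by (auto simp: P_def card_2_iff)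
      with X rs C4 show False
        by (auto simp: P_def D_def C4_free_def)
    qed
  qed (auto simp: finP)
  also have "\<dots> \<le> card {X. X \<subseteq> {1..n} \<and> card X = 2}"
    using D_sub by (intro card_mono) (auto simp: P_def)
  also have "\<dots> = n choose 2"
    by (simp add: n_subsets)
  finally show ?thesis by simp
qed

lemma zarankiewicz_eqI:
  assumes "E \<subseteq> grid m n" "C4_free E" "card E = m + (n choose 2)"
  shows "zarankiewicz m n = m + (n choose 2)"
  unfolding zarankiewicz_def
proof (rule Max_attained)
  show "m + (n choose 2) \<in> {card E |E. E \<subseteq> grid m n \<and> C4_free E}"
    unfolding mem_Collect_eq using assms by (intro exI[of _ E]) simp
next
  fix x assume "x \<in> {card E |E. E \<subseteq> grid m n \<and> C4_free E}"
  thus "x \<le> m + (n choose 2)"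
    unfolding mem_Collect_eq using C4_free_card_le by blast
qed

section \<open>Counting the cells of a configuration\<close>

lemma edge_elements_alt: "edge_elements E1 E2 = (\<lambda>p. {p}) ` E1 \<union> E2"
  by (auto simp: edge_elements_def)

lemma simple_configD:
  assumes "simple_config m n E1 E2"
  shows "E1 \<subseteq> grid m n" "e \<in> E2 \<Longrightarrow> e \<subseteq> grid m n" "e \<in> E2 \<Longrightarrow> card e = 2" "C4_free E1"
    "a \<in> edge_elements E1 E2 \<Longrightarrow> b \<in> edge_elements E1 E2 \<Longrightarrow> p \<in> a \<Longrightarrow> p \<in> b \<Longrightarrow> a = b"
  using assms unfolding simple_config_def configuration_def
  by (simp_all only: simp_thms) (metis disjoint_iff)

lemma simple_config_finite:
  assumes "simple_config m n E1 E2"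
  shows "finite E1" "finite E2" "finite (edge_elements E1 E2)"
proof -
  show 1: "finite E1"
    using finite_subset[OF simple_configD(1)[OF assms] finite_grid] .
  have "E2 \<subseteq> Pow (grid m n)"
    using simple_configD(2)[OF assms] by blast
  thus 2: "finite E2"
    by (rule finite_subset) (simp add: finite_grid)
  show "finite (edge_elements E1 E2)"
    using 1 2 by (simp add: edge_elements_alt)
qed

lemma one_edges_Int_two_edges:
  assumes "simple_config m n E1 E2"
  shows "(\<lambda>p. {p}) ` E1 \<inter> E2 = {}"
proof (rule equals0I)
  fix a assume a: "a \<in> (\<lambda>p. {p}) ` E1 \<inter> E2"
  hence "card a = 1" by auto
  with a simple_configD(3)[OF assms, of a] show False by simp
qed

lemma card_edge_elements:
  assumes "simple_config m n E1 E2"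
  shows "card (edge_elements E1 E2) = card E1 + card E2"
proof -
  have "card ((\<lambda>p. {p}) ` E1 \<union> E2) = card ((\<lambda>p. {p}) ` E1) + card E2"
    using simple_config_finite[OF assms] one_edges_Int_two_edges[OF assms]
    by (intro card_Un_disjoint) auto
  moreover have "card ((\<lambda>p. {p}) ` E1) = card E1"
    by (rule card_image) (auto simp: inj_on_def)
  ultimately show ?thesis
    by (simp add: edge_elements_alt)
qed

lemma occupied_Union: "occupied E1 E2 = \<Union> (edge_elements E1 E2)"
  by (auto simp: occupied_def edge_elements_def)

lemma occupied_subset_grid:
  assumes "simple_config m n E1 E2"
  shows "occupied E1 E2 \<subseteq> grid m n"
  using simple_configD(1,2)[OF assms] by (auto simp: occupied_def)

text \<open>With \<open>card E1\<close> prescribed by limitedness, this identity bounds the number of two-edges, and the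
  holes are precisely what is lost against the bound.\<close>

lemma cell_count:
  assumes sc: "simple_config m n E1 E2"
  shows "card E1 + 2 * card E2 + holes m n E1 E2 = m * n"
proof -
  note D = simple_configD[OF sc]
  have fin: "finite e" if "e \<in> E2" for e
    using D(2)[OF that] finite_subset finite_grid by blast
  have disj: "E1 \<inter> \<Union>E2 = {}"
  proof (rule equals0I)
    fix p assume "p \<in> E1 \<inter> \<Union>E2"
    then obtain e where e: "p \<in> E1" "e \<in> E2" "p \<in> e" by blast
    hence "e = {p}"
      using D(5)[of e "{p}" p] unfolding edge_elements_alt by blast
    with D(3)[OF e(2)] show False by simp
  qed
  have "pairwise disjnt E2"
    unfolding pairwise_def disjnt_def using D(5) unfolding edge_elements_alt by blast
  hence "card (\<Union>E2) = (\<Sum>e\<in>E2. card e)"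
    using fin by (intro card_Union_disjoint) auto
  also have "\<dots> = 2 * card E2"
    using D(3) by simp
  finally have "card (occupied E1 E2) = card E1 + 2 * card E2"
    unfolding occupied_def using disj simple_config_finite[OF sc] fin
    by (subst card_Un_disjoint) auto
  moreover have "card (grid m n - occupied E1 E2) = card (grid m n) - card (occupied E1 E2)"
    using occupied_subset_grid[OF sc] finite_grid finite_subset by (intro card_Diff_subset) blast+
  moreover have "card (occupied E1 E2) \<le> card (grid m n)"
    using occupied_subset_grid[OF sc] finite_grid by (rule card_mono[rotated])
  ultimately show ?thesis
    by (simp add: holes_def grid_def)
qed

section \<open>Sums of squares and their Gram vectors\<close>

text \<open>A family \<open>v\<close> of matrices indexed by \<open>I\<close> attaches to the cell \<open>p\<close> the vector with coordinates
  \<open>v i p\<close>. These are the vectors for which the formal \<open>v\<^sub>p\<close> of the certified relations stand.\<close>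

definition gram :: "('i \<Rightarrow> cell \<Rightarrow> real) \<Rightarrow> 'i set \<Rightarrow> cell \<Rightarrow> cell \<Rightarrow> real" where
  "gram v I p q = (\<Sum>i\<in>I. v i p * v i q)"

lemma gram_sym: "gram v I p q = gram v I q p"
  by (simp add: gram_def mult.commute)

definition sq_sum :: "nat \<Rightarrow> nat \<Rightarrow> ('i \<Rightarrow> cell \<Rightarrow> real) \<Rightarrow> 'i set \<Rightarrow> (nat \<Rightarrow> real) \<Rightarrow> (nat \<Rightarrow> real) \<Rightarrow> real" where
  "sq_sum m n v I x y = (\<Sum>i\<in>I. (bilinear_form m n (curry (v i)) x y)\<^sup>2)"

lemma bilinear_form_two_points:
  assumes "r \<in> {1..m}" "s \<in> {1..m}" "c \<in> {1..n}" "d \<in> {1..n}"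
  shows "bilinear_form m n b (\<lambda>i. (if i = r then \<alpha> else 0) + (if i = s then \<beta> else 0))
           (\<lambda>i. (if i = c then \<gamma> else 0) + (if i = d then \<delta> else 0))
         = \<alpha> * \<gamma> * b r c + \<alpha> * \<delta> * b r d + \<beta> * \<gamma> * b s c + \<beta> * \<delta> * b s d"
proof -
  have two: "(\<Sum>i=1..k. f i * ((if i = u then \<alpha> else 0) + (if i = w then \<beta> else 0)))
      = f u * \<alpha> + f w * \<beta>"
    if "u \<in> {1..k}" "w \<in> {1..k}" for f :: "nat \<Rightarrow> real" and k u w \<alpha> \<beta>
  proof -
    have "(\<Sum>i=1..k. f i * ((if i = u then \<alpha> else 0) + (if i = w then \<beta> else 0)))
        = (\<Sum>i\<in>{1..k}. (if i = u then f i * \<alpha> else 0) + (if i = w then f i * \<beta> else 0))"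
      by (intro sum.cong) (auto simp: distrib_left)
    also have "\<dots> = f u * \<alpha> + f w * \<beta>"
      using that by (simp only: sum.distrib sum.delta finite_atLeastAtMost if_True)
    finally show ?thesis .
  qed
  have "bilinear_form m n b (\<lambda>i. (if i = r then \<alpha> else 0) + (if i = s then \<beta> else 0))
           (\<lambda>i. (if i = c then \<gamma> else 0) + (if i = d then \<delta> else 0))
        = (\<Sum>i=1..m. (b i c * \<gamma> + b i d * \<delta>) *
             ((if i = r then \<alpha> else 0) + (if i = s then \<beta> else 0)))"
    unfolding bilinear_form_def two[OF assms(3,4)] by (intro sum.cong refl) algebra
  thus ?thesis
    unfolding two[OF assms(1,2)] by (simp add: algebra_simps)
qed

text \<open>Points supported on two rows and two columns (possibly equal) see all coefficients of the form
  that involve these lines. The two diagonals of the rectangle enter only through the sum of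
  their inner products, because both contribute to the same monomial \<open>x\<^sub>r x\<^sub>s y\<^sub>c y\<^sub>d\<close>.\<close>

lemma sq_sum_two_points:
  assumes "r \<in> {1..m}" "s \<in> {1..m}" "c \<in> {1..n}" "d \<in> {1..n}"
  shows "sq_sum m n v I (\<lambda>i. (if i = r then \<alpha> else 0) + (if i = s then \<beta> else 0))
           (\<lambda>i. (if i = c then \<gamma> else 0) + (if i = d then \<delta> else 0))
    = \<alpha>\<^sup>2 * \<gamma>\<^sup>2 * gram v I (r, c) (r, c) + \<alpha>\<^sup>2 * \<delta>\<^sup>2 * gram v I (r, d) (r, d)
    + \<beta>\<^sup>2 * \<gamma>\<^sup>2 * gram v I (s, c) (s, c) + \<beta>\<^sup>2 * \<delta>\<^sup>2 * gram v I (s, d) (s, d)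
    + 2 * \<alpha>\<^sup>2 * \<gamma> * \<delta> * gram v I (r, c) (r, d) + 2 * \<beta>\<^sup>2 * \<gamma> * \<delta> * gram v I (s, c) (s, d)
    + 2 * \<alpha> * \<beta> * \<gamma>\<^sup>2 * gram v I (r, c) (s, c) + 2 * \<alpha> * \<beta> * \<delta>\<^sup>2 * gram v I (r, d) (s, d)
    + 2 * \<alpha> * \<beta> * \<gamma> * \<delta> * (gram v I (r, c) (s, d) + gram v I (r, d) (s, c))"
  unfolding sq_sum_def bilinear_form_two_points[OF assms] curry_def gram_def sum_distrib_left
    sum.distrib[symmetric]
  by (intro sum.cong refl) algebra

text \<open>Comparison of coefficients by polarization: suitable signs \<open>\<alpha>, \<beta>, \<gamma>, \<delta>\<close> single out one
  coefficient each. The fourth equation is the source of the rectangle rule.\<close>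

lemma sq_sum_eq_imp_gram_eq:
  assumes eq: "\<And>x y. sq_sum m n v I x y = sq_sum m n w J x y"
    and rs: "r \<in> {1..m}" "s \<in> {1..m}" "c \<in> {1..n}" "d \<in> {1..n}"
  shows "gram v I (r, c) (r, c) = gram w J (r, c) (r, c)"
    and "gram v I (r, c) (r, d) = gram w J (r, c) (r, d)"
    and "gram v I (r, c) (s, c) = gram w J (r, c) (s, c)"
    and "gram v I (r, c) (s, d) + gram v I (r, d) (s, c)
       = gram w J (r, c) (s, d) + gram w J (r, d) (s, c)"
proof -
  have "sq_sum m n v I (\<lambda>i. (if i = r then \<alpha> else 0) + (if i = s then \<beta> else 0))
           (\<lambda>i. (if i = c then \<gamma> else 0) + (if i = d then \<delta> else 0))
      = sq_sum m n w J (\<lambda>i. (if i = r then \<alpha> else 0) + (if i = s then \<beta> else 0))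
           (\<lambda>i. (if i = c then \<gamma> else 0) + (if i = d then \<delta> else 0))" for \<alpha> \<beta> \<gamma> \<delta>
    by (rule eq)
  note Q = this[unfolded sq_sum_two_points[OF rs]]
  show "gram v I (r, c) (r, c) = gram w J (r, c) (r, c)"
    using Q[where \<alpha> = 1 and \<beta> = 0 and \<gamma> = 1 and \<delta> = 0] by simp
  show "gram v I (r, c) (r, d) = gram w J (r, c) (r, d)"
    using Q[where \<alpha> = 1 and \<beta> = 0 and \<gamma> = 1 and \<delta> = 1]
      Q[where \<alpha> = 1 and \<beta> = 0 and \<gamma> = 1 and \<delta> = "-1"] by simp
  show "gram v I (r, c) (s, c) = gram w J (r, c) (s, c)"
    using Q[where \<alpha> = 1 and \<beta> = 1 and \<gamma> = 1 and \<delta> = 0]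
      Q[where \<alpha> = 1 and \<beta> = "-1" and \<gamma> = 1 and \<delta> = 0] by simp
  show "gram v I (r, c) (s, d) + gram v I (r, d) (s, c)
      = gram w J (r, c) (s, d) + gram w J (r, d) (s, c)"
    using Q[where \<alpha> = 1 and \<beta> = 1 and \<gamma> = 1 and \<delta> = 1]
      Q[where \<alpha> = 1 and \<beta> = "-1" and \<gamma> = 1 and \<delta> = 1]
      Q[where \<alpha> = 1 and \<beta> = 1 and \<gamma> = "-1" and \<delta> = 1]
      Q[where \<alpha> = 1 and \<beta> = "-1" and \<gamma> = "-1" and \<delta> = 1] by simp
qed

section \<open>Soundness of certified values\<close>

definition same_edge :: "cell set \<Rightarrow> cell set set \<Rightarrow> cell \<Rightarrow> cell \<Rightarrow> bool" where
  "same_edge E1 E2 p q \<longleftrightarrow> (\<exists>e\<in>edge_elements E1 E2. p \<in> e \<and> q \<in> e)"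

text \<open>The vectors of the representation by which the form of a configuration is defined: its squares
  are indexed by the edge elements, and the two halves of a two-edge share a unit vector.\<close>

definition edge_vec :: "cell set \<Rightarrow> cell \<Rightarrow> real" where
  "edge_vec e p = of_bool (p \<in> e)"

lemma gram_edge_vec:
  assumes "simple_config m n E1 E2"
  shows "gram edge_vec (edge_elements E1 E2) p q = of_bool (same_edge E1 E2 p q)"
proof (cases "same_edge E1 E2 p q")
  case True
  then obtain e where e: "e \<in> edge_elements E1 E2" "p \<in> e" "q \<in> e"
    by (auto simp: same_edge_def)
  have "gram edge_vec (edge_elements E1 E2) p q
      = (\<Sum>f\<in>edge_elements E1 E2. if f = e then 1 else 0)"
    unfolding gram_def
  proof (intro sum.cong refl)
    fix f assume f: "f \<in> edge_elements E1 E2"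
    show "edge_vec f p * edge_vec f q = (if f = e then 1 else 0)"
    proof (cases "f = e")
      case False
      hence "p \<notin> f"
        using simple_configD(5)[OF assms f e(1) _ e(2)] by blast
      with False show ?thesis by (simp add: edge_vec_def)
    qed (simp add: edge_vec_def e)
  qed
  thus ?thesis
    using True e simple_config_finite[OF assms] by simp
next
  case False
  hence "gram edge_vec (edge_elements E1 E2) p q = 0"
    unfolding gram_def by (intro sum.neutral) (auto simp: edge_vec_def same_edge_def)
  thus ?thesis using False by simp
qed

lemma same_edge_refl: "same_edge E1 E2 p p \<longleftrightarrow> p \<in> occupied E1 E2"
  by (auto simp: same_edge_def occupied_Union)

lemma delta_eq_same_edge:
  assumes "simple_config m n E1 E2" "p \<noteq> q"
  shows "delta E2 p q = of_bool (same_edge E1 E2 p q)"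
proof -
  have "{p, q} \<in> E2" if pq: "same_edge E1 E2 p q"
  proof -
    obtain e where e: "e \<in> edge_elements E1 E2" "p \<in> e" "q \<in> e"
      using pq by (auto simp: same_edge_def)
    have "e \<in> E2"
      using e assms(2) by (auto simp: edge_elements_def)
    moreover from this have "card e = 2"
      by (rule simple_configD(3)[OF assms(1)])
    hence "e = {p, q}"
      using e assms(2) by (auto simp: card_2_iff)
    ultimately show ?thesis by simp
  qed
  thus ?thesis
    by (auto simp: delta_def same_edge_def edge_elements_def)
qed

lemma sq_sum_edge_vec:
  assumes sc: "simple_config m n E1 E2"
  shows "sq_sum m n edge_vec (edge_elements E1 E2) x y = biquadratic_form E1 E2 x y"
proof -
  have bil: "bilinear_form m n (curry (edge_vec e)) x y = (\<Sum>(r, c)\<in>e. x r * y c)"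
    if "e \<subseteq> grid m n" for e
  proof -
    have "bilinear_form m n (curry (edge_vec e)) x y
        = (\<Sum>(r, c)\<in>grid m n. if (r, c) \<in> e then x r * y c else 0)"
      unfolding bilinear_form_def grid_def sum.cartesian_product
      by (intro sum.cong) (auto simp: edge_vec_def)
    also have "\<dots> = (\<Sum>p\<in>grid m n. if p \<in> e then (\<lambda>(r, c). x r * y c) p else 0)"
      by (intro sum.cong) auto
    also have "\<dots> = (\<Sum>(r, c)\<in>e. x r * y c)"
      using that by (simp only: sum.inter_restrict[OF finite_grid, symmetric] Int_absorb1)
    finally show ?thesis .
  qed
  have "sq_sum m n edge_vec (edge_elements E1 E2) x y
      = sq_sum m n edge_vec ((\<lambda>p. {p}) ` E1) x y + sq_sum m n edge_vec E2 x y"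
    unfolding sq_sum_def edge_elements_alt
    using simple_config_finite[OF sc] one_edges_Int_two_edges[OF sc]
    by (intro sum.union_disjoint) auto
  also have "sq_sum m n edge_vec E2 x y = (\<Sum>e\<in>E2. (\<Sum>(r, c)\<in>e. x r * y c)\<^sup>2)"
    unfolding sq_sum_def using bil simple_configD(2)[OF sc] by (intro sum.cong) auto
  also have "sq_sum m n edge_vec ((\<lambda>p. {p}) ` E1) x y = (\<Sum>p\<in>E1. (\<Sum>(r, c)\<in>{p}. x r * y c)\<^sup>2)"
    unfolding sq_sum_def using bil simple_configD(1)[OF sc]
    by (subst sum.reindex) (auto simp: inj_on_def intro!: sum.cong)
  also have "\<dots> = (\<Sum>(r, c)\<in>E1. (x r)\<^sup>2 * (y c)\<^sup>2)"
    by (intro sum.cong) (auto simp: power_mult_distrib)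
  finally show ?thesis
    by (simp add: biquadratic_form_def)
qed

lemma certified_in_grid:
  assumes "simple_config m n E1 E2" "certified m n E1 E2 p q a"
  shows "p \<in> grid m n \<and> q \<in> grid m n"
  using assms(2) by induction (auto simp: grid_def)

text \<open>Every rule is a valid inference about the Gram vectors of an arbitrary representation as a sum
  of squares: by comparison with the defining representation for the line and rectangle rules, and
  because unit vectors with inner product 1 coincide for saturation. In the complementary case two
  inner products of unit vectors add up to 2, so both are 1.\<close>

lemma certified_gram:
  assumes sc: "simple_config m n E1 E2" and fin: "finite I"
    and sos: "\<And>x y. biquadratic_form E1 E2 x y = sq_sum m n v I x y"
    and cert: "certified m n E1 E2 p q a"
  shows "gram v I p q = a"
proof -
  have eq: "sq_sum m n v I x y = sq_sum m n edge_vec (edge_elements E1 E2) x y" for x y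
    using sos sq_sum_edge_vec[OF sc] by simp
  note pol = sq_sum_eq_imp_gram_eq[OF eq, unfolded gram_edge_vec[OF sc]]
  have norm: "gram v I p p = of_bool (p \<in> occupied E1 E2)" if "p \<in> grid m n" for p
    using that pol(1)[of "fst p" "fst p" "snd p" "snd p"]
    by (auto simp: grid_def same_edge_refl)
  have diff: "(\<Sum>i\<in>I. (v i p - v i q)\<^sup>2) = gram v I p p + gram v I q q - 2 * gram v I p q" for p q
    unfolding gram_def sum_distrib_left sum.distrib[symmetric] sum_subtractf[symmetric]
    by (intro sum.cong refl) algebra
  have le1: "gram v I p q \<le> 1" if "p \<in> grid m n" "q \<in> grid m n" for p q
  proof -
    have "0 \<le> (\<Sum>i\<in>I. (v i p - v i q)\<^sup>2)"
      by (simp add: sum_nonneg)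
    thus ?thesis
      unfolding diff norm[OF that(1)] norm[OF that(2)] by (simp split: split_of_bool_asm)
  qed
  from cert show ?thesis
  proof induction
    case (sym p q a)
    thus ?case by (simp add: gram_sym)
  next
    case (unit p)
    thus ?case using norm by simp
  next
    case (hole p q)
    have zero: "v i z = 0" if "z \<in> grid m n" "z \<notin> occupied E1 E2" "i \<in> I" for z i
    proof -
      have "(\<Sum>i\<in>I. v i z * v i z) = 0"
        using norm[OF that(1)] that(2) by (simp add: gram_def)
      thus ?thesis
        using that(3) fin by (simp add: sum_nonneg_eq_0_iff)
    qed
    show ?case
      unfolding gram_def using hole zero[of p] zero[of q]
      by (intro sum.neutral ballI) (metis mult_eq_0_iff)
  next
    case (line p q)
    thus ?case
      unfolding delta_eq_same_edge[OF sc line(3)]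
      using pol(2)[of "fst p" "fst p" "snd p" "snd q"] pol(3)[of "fst p" "fst q" "snd p" "snd p"]
      by (cases p; cases q) (auto simp: grid_def)
  next
    case (rectangle r s c d a)
    thus ?case
      using pol(4)[of r s c d] by (simp add: delta_eq_same_edge[OF sc])
  next
    case (complementary r s c d)
    have "gram v I (r, c) (s, d) + gram v I (r, d) (s, c)
        = delta E2 (r, c) (s, d) + delta E2 (r, d) (s, c)"
      using complementary pol(4)[of r s c d] by (simp add: delta_eq_same_edge[OF sc])
    also have "\<dots> = 2"
      using complementary by (simp add: delta_def)
    finally show ?case
      using complementary le1[of "(r, c)" "(s, d)"] le1[of "(r, d)" "(s, c)"]
      by (simp add: grid_def)
  next
    case (saturation p p' q a)
    have "p \<in> grid m n" "p' \<in> grid m n"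
      using certified_in_grid[OF sc saturation(1)] by auto
    hence "(\<Sum>i\<in>I. (v i p - v i p')\<^sup>2) \<le> 0"
      unfolding diff saturation.IH(1) by (simp add: norm)
    hence "(\<Sum>i\<in>I. (v i p - v i p')\<^sup>2) = 0"
      by (simp add: sum_nonneg antisym)
    hence "v i p = v i p'" if "i \<in> I" for i
      using that fin by (simp add: sum_nonneg_eq_0_iff)
    hence "gram v I p' q = gram v I p q"
      unfolding gram_def by (intro sum.cong) auto
    thus ?case using saturation by simp
  qed
qed

text \<open>Applied to the defining representation, soundness determines the only value that can be
  certified for a pair of cells.\<close>

lemma certified_imp_same_edge:
  assumes "simple_config m n E1 E2" "certified m n E1 E2 p q a"
  shows "a = of_bool (same_edge E1 E2 p q)"
proof -
  have "gram edge_vec (edge_elements E1 E2) p q = a"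
    by (rule certified_gram[OF assms(1) simple_config_finite(3)[OF assms(1)]
          sq_sum_edge_vec[OF assms(1), symmetric] assms(2)])
  thus ?thesis
    by (simp only: gram_edge_vec[OF assms(1)])
qed

text \<open>The coordinates of an orthonormal family satisfy Bessel's inequality
  \<open>(\<Sum>a\<in>A. (u a i)\<^sup>2) \<le> 1\<close>; summation over the coordinates counts the family.\<close>

lemma orthonormal_card_le:
  fixes u :: "'a \<Rightarrow> 'i \<Rightarrow> real"
  assumes "finite A" "finite I"
    and on: "\<And>a b. a \<in> A \<Longrightarrow> b \<in> A \<Longrightarrow> (\<Sum>i\<in>I. u a i * u b i) = of_bool (a = b)"
  shows "card A \<le> card I"
proof -
  have bessel: "(\<Sum>a\<in>A. (u a i)\<^sup>2) \<le> 1" if i: "i \<in> I" for i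
  proof -
    \<comment> \<open>The projection \<open>z\<close> of the \<open>i\<close>-th unit vector to the span of the family has \<open>i\<close>-th coordinate \<open>T\<close>
      and squared norm \<open>T\<close>.\<close>
    define T where "T = (\<Sum>a\<in>A. (u a i)\<^sup>2)"
    define z where "z j = (\<Sum>a\<in>A. u a i * u a j)" for j
    have "T\<^sup>2 = (z i)\<^sup>2"
      by (simp add: T_def z_def power2_eq_square)
    also have "\<dots> \<le> (\<Sum>j\<in>I. (z j)\<^sup>2)"
      using i assms(2) by (intro member_le_sum) auto
    also have "\<dots> = (\<Sum>j\<in>I. \<Sum>a\<in>A. \<Sum>b\<in>A. u a i * u b i * (u a j * u b j))"
      unfolding z_def power2_eq_square sum_product by (intro sum.cong refl) algebra
    also have "\<dots> = (\<Sum>a\<in>A. \<Sum>j\<in>I. \<Sum>b\<in>A. u a i * u b i * (u a j * u b j))"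
      by (rule sum.swap)
    also have "\<dots> = (\<Sum>a\<in>A. \<Sum>b\<in>A. \<Sum>j\<in>I. u a i * u b i * (u a j * u b j))"
      by (intro sum.cong refl sum.swap)
    also have "\<dots> = (\<Sum>a\<in>A. \<Sum>b\<in>A. if b = a then (u a i)\<^sup>2 else 0)"
      by (intro sum.cong refl) (auto simp: sum_distrib_left[symmetric] on power2_eq_square)
    also have "\<dots> = T"
      using assms(1) by (simp add: T_def)
    finally have "T * (T - 1) \<le> 0"
      by (simp add: power2_eq_square algebra_simps)
    moreover have "T \<ge> 0"
      by (simp add: T_def sum_nonneg)
    ultimately have "T \<le> 1"
      using mult_pos_pos[of T "T - 1"] by linarith
    thus ?thesis
      by (simp only: T_def)
  qed
  have "real (card A) = (\<Sum>a\<in>A. \<Sum>i\<in>I. (u a i)\<^sup>2)"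
    using on by (simp add: power2_eq_square)
  also have "\<dots> = (\<Sum>i\<in>I. \<Sum>a\<in>A. (u a i)\<^sup>2)"
    by (rule sum.swap)
  also have "\<dots> \<le> (\<Sum>i\<in>I. 1)"
    using bessel by (rule sum_mono)
  finally show ?thesis by simp
qed

text \<open>In any representation as a sum of \<open>k\<close> squares, the Gram vectors of representatives of the edge
  elements are orthonormal in \<open>\<real>\<^sup>k\<close>, whence \<open>k\<close> is at least the number of edge elements.\<close>

lemma RW3plus_imp_irreducible:
  assumes sc: "simple_config m n E1 E2" and RW: "RW3plus m n E1 E2"
  shows "irreducible_config m n E1 E2"
proof -
  define EE where "EE = edge_elements E1 E2"
  have RW_sim: "certified m n E1 E2 p q 1" if "{p, q} \<in> E2" for p q
    using conjunct1[OF RW[unfolded RW3plus_def]] that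
    by (simp only: sim_rel_def mem_Collect_eq case_prod_conv)
  have RW_perp: "\<exists>p\<in>a. \<exists>q\<in>b. certified m n E1 E2 p q 0" if "a \<in> EE" "b \<in> EE" "a \<noteq> b" for a b
    using conjunct2[OF conjunct2[OF RW[unfolded RW3plus_def]]] that
    unfolding perp_rel_def mem_Collect_eq case_prod_conv EE_def by blast
  have finEE: "finite EE" and cardEE: "card EE = card E1 + card E2"
    unfolding EE_def using simple_config_finite[OF sc] card_edge_elements[OF sc] by auto
  have low: "card EE \<le> k"
    if sos: "\<forall>x y. biquadratic_form E1 E2 x y = (\<Sum>i<k. (bilinear_form m n (b i) x y)\<^sup>2)" for k b
  proof -
    define v where "v i = case_prod (b i)" for i :: nat
    have "biquadratic_form E1 E2 x y = sq_sum m n v {..<k} x y" for x y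
      using sos by (simp add: sq_sum_def v_def)
    note gram = certified_gram[OF sc _ this, simplified]
    have ne: "e \<noteq> {}" if "e \<in> EE" for e
      using that simple_configD(3)[OF sc, of e] by (auto simp: EE_def edge_elements_def)
    define rep where "rep e = (SOME p. p \<in> e)" for e :: "cell set"
    have rep: "rep e \<in> e" if "e \<in> EE" for e
      using ne[OF that] some_in_eq by (auto simp: rep_def)
    have to_rep: "certified m n E1 E2 p (rep e) 1" if e: "e \<in> EE" "p \<in> e" for e p
    proof (cases "p = rep e")
      case True
      have "p \<in> occupied E1 E2"
        using e by (auto simp: EE_def occupied_Union)
      thus ?thesis
        using occupied_subset_grid[OF sc] True by (auto intro: certified.unit)
    next
      case False
      hence "e \<in> E2"
        using e rep[OF e(1)] by (auto simp: EE_def edge_elements_def)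
      moreover from this have "card e = 2"
        by (rule simple_configD(3)[OF sc])
      hence "e = {p, rep e}"
        using e rep[OF e(1)] False by (auto simp: card_2_iff)
      ultimately have "{p, rep e} \<in> E2" by simp
      thus ?thesis
        by (rule RW_sim)
    qed
    have "gram v {..<k} (rep e) (rep f) = of_bool (e = f)" if ef: "e \<in> EE" "f \<in> EE" for e f
    proof (cases "e = f")
      case True
      thus ?thesis
        using gram[OF to_rep[OF ef(1) rep[OF ef(1)]]] by simp
    next
      case False
      then obtain p q where pq: "p \<in> e" "q \<in> f" "certified m n E1 E2 p q 0"
        using RW_perp ef by blast
      have "certified m n E1 E2 (rep e) q 0"
        using certified.saturation[OF to_rep[OF ef(1) pq(1)] pq(3)] .
      hence "certified m n E1 E2 (rep f) (rep e) 0"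
        using certified.saturation[OF to_rep[OF ef(2) pq(2)] certified.sym] by blast
      thus ?thesis
        using gram[of "rep f" "rep e" 0] gram_sym[of v "{..<k}" "rep e"] False by simp
    qed
    hence "card EE \<le> card {..<k}"
      using finEE by (intro orthonormal_card_le[where u = "\<lambda>e i. v i (rep e)"])
        (auto simp: gram_def)
    thus ?thesis by simp
  qed
  \<comment> \<open>The number of edge elements is attained by the defining representation.\<close>
  obtain h where h: "bij_betw h {..<card EE} EE"
    using ex_bij_betw_nat_finite[OF finEE] by (auto simp: atLeast0LessThan)
  have "biquadratic_form E1 E2 x y
      = (\<Sum>i<card EE. (bilinear_form m n (curry (edge_vec (h i))) x y)\<^sup>2)" for x y
    unfolding sq_sum_edge_vec[OF sc, symmetric] sq_sum_def EE_def[symmetric]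
    by (rule sum.reindex_bij_betw[OF h, symmetric])
  hence "sos_rank m n (biquadratic_form E1 E2) = card EE"
    unfolding sos_rank_def using low
    by (intro Least_equality exI[of _ "\<lambda>i. curry (edge_vec (h i))"]) auto
  thus ?thesis
    by (simp add: irreducible_config_def cardEE)
qed

text \<open>Soundness makes it impossible to identify two different two-edges, so distinctness of their
  classes need not be derived: it suffices that all pairs of cells have a certified value.\<close>

lemma RW3plusI:
  assumes sc: "simple_config m n E1 E2"
    and all: "\<And>p q. p \<in> occupied E1 E2 \<Longrightarrow> q \<in> occupied E1 E2 \<Longrightarrow>
      certified m n E1 E2 p q (of_bool (same_edge E1 E2 p q))"
  shows "RW3plus m n E1 E2"
  unfolding RW3plus_def
proof (intro conjI allI impI ballI)
  fix p q assume "{p, q} \<in> E2"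
  hence "same_edge E1 E2 p q" "p \<in> occupied E1 E2" "q \<in> occupied E1 E2"
    by (auto simp: same_edge_def edge_elements_def occupied_def)
  thus "(p, q) \<in> sim_rel m n E1 E2"
    using all[of p q] by (simp add: sim_rel_def)
next
  fix e f p q assume ef: "e \<in> E2" "f \<in> E2" "e \<noteq> f" "p \<in> e" "q \<in> f"
  have "\<not> same_edge E1 E2 p q"
    using ef simple_configD(5)[OF sc] unfolding same_edge_def edge_elements_alt by blast
  hence "(p, q) \<notin> sim_rel m n E1 E2"
    using certified_imp_same_edge[OF sc, of p q 1] by (auto simp: sim_rel_def)
  moreover have "q \<in> occupied E1 E2"
    using ef by (auto simp: occupied_def)
  hence "(q, q) \<in> sim_rel m n E1 E2"
    using all[of q q] by (simp add: sim_rel_def same_edge_refl)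
  ultimately show "sim_rel m n E1 E2 `` {p} \<noteq> sim_rel m n E1 E2 `` {q}"
    by blast
next
  fix a b assume ab: "a \<in> edge_elements E1 E2" "b \<in> edge_elements E1 E2" "a \<noteq> b"
  have "e \<noteq> {}" if "e \<in> edge_elements E1 E2" for e
    using that simple_configD(3)[OF sc, of e] by (auto simp: edge_elements_def)
  then obtain p q where pq: "p \<in> a" "q \<in> b"
    using ab by blast
  have "\<not> same_edge E1 E2 p q"
    using ab pq simple_configD(5)[OF sc] unfolding same_edge_def by blast
  moreover have "p \<in> occupied E1 E2" "q \<in> occupied E1 E2"
    using ab pq by (auto simp: occupied_Union)
  ultimately show "\<exists>p\<in>a. \<exists>q\<in>b. (p, q) \<in> perp_rel m n E1 E2"
    using all[of p q] pq by (auto simp: perp_rel_def)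
qed

section \<open>Propagation of certified values\<close>

locale full_config =
  fixes m n :: nat and E1 :: "cell set" and E2 :: "cell set set"
  assumes simple: "simple_config m n E1 E2"
    and full: "occupied E1 E2 = grid m n"
begin

text \<open>The value is the only one that can be certified. In terms of \<open>linked\<close>, the rules no longer
  mention values: they only propagate the information that a value is certified.\<close>

definition linked :: "cell \<Rightarrow> cell \<Rightarrow> bool" where
  "linked p q \<longleftrightarrow> certified m n E1 E2 p q (of_bool (same_edge E1 E2 p q))"

lemma same_edge_sym: "same_edge E1 E2 p q \<longleftrightarrow> same_edge E1 E2 q p"
  by (auto simp: same_edge_def)

lemma same_edge_left_cong:
  assumes "same_edge E1 E2 p p'"
  shows "same_edge E1 E2 p q \<longleftrightarrow> same_edge E1 E2 p' q"
proof -
  obtain e where e: "e \<in> edge_elements E1 E2" "p \<in> e" "p' \<in> e"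
    using assms by (auto simp: same_edge_def)
  have "f = e" if "f \<in> edge_elements E1 E2" "p \<in> f \<or> p' \<in> f" for f
    using that e simple_configD(5)[OF simple that(1) e(1)] by blast
  thus ?thesis
    unfolding same_edge_def using e by blast
qed

lemma linked_sym: "linked p q \<Longrightarrow> linked q p"
  unfolding linked_def same_edge_sym[of q p] by (rule certified.sym)

lemma linked_grid: "linked p q \<Longrightarrow> p \<in> grid m n \<and> q \<in> grid m n"
  unfolding linked_def using certified_in_grid[OF simple] by blast

lemma linked_collinear:
  assumes "p \<in> grid m n" "q \<in> grid m n" "fst p = fst q \<or> snd p = snd q"
  shows "linked p q"
proof (cases "p = q")
  case True
  thus ?thesis
    using certified.unit[of p m n E1 E2] assms full by (simp add: linked_def same_edge_refl)
next
  case False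
  have "certified m n E1 E2 p q (delta E2 p q)"
    by (rule certified.line[OF assms(1,2) False assms(3)])
  thus ?thesis
    unfolding linked_def delta_eq_same_edge[OF simple False] .
qed

text \<open>The degenerate cases are included, so that a rectangle step may be taken without looking at the
  position of the cells.\<close>

lemma linked_rectangle:
  assumes "linked (r, c) (s, d)"
  shows "linked (r, d) (s, c)"
proof -
  note g = linked_grid[OF assms]
  show ?thesis
  proof (cases "r = s \<or> c = d")
    case True
    thus ?thesis
      using g by (intro linked_collinear) (auto simp: grid_def)
  next
    case False
    hence "certified m n E1 E2 (r, d) (s, c)
        (delta E2 (r, c) (s, d) + delta E2 (r, d) (s, c) - of_bool (same_edge E1 E2 (r, c) (s, d)))"
      using assms g unfolding linked_def by (intro certified.rectangle) (auto simp: grid_def)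
    moreover have "delta E2 (r, c) (s, d) = of_bool (same_edge E1 E2 (r, c) (s, d))"
      "delta E2 (r, d) (s, c) = of_bool (same_edge E1 E2 (r, d) (s, c))"
      using False by (intro delta_eq_same_edge[OF simple]; simp)+
    ultimately show ?thesis
      by (simp only: linked_def add_diff_cancel_left')
  qed
qed

lemma linked_complementary:
  assumes "{(r, c), (s, d)} \<in> E2" "{(r, d), (s, c)} \<in> E2"
  shows "linked (r, c) (s, d)"
proof -
  have g: "(r, c) \<in> grid m n" "(s, d) \<in> grid m n"
    using simple_configD(2)[OF simple assms(1)] by auto
  show ?thesis
  proof (cases "r = s \<or> c = d")
    case True
    thus ?thesis
      using g by (intro linked_collinear) auto
  next
    case False
    hence "certified m n E1 E2 (r, c) (s, d) 1"
      using g assms by (intro certified.complementary) (auto simp: grid_def)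
    moreover have "same_edge E1 E2 (r, c) (s, d)"
      unfolding same_edge_def edge_elements_def using assms(1) by blast
    ultimately show ?thesis
      by (simp only: linked_def of_bool_eq)
  qed
qed

lemma linked_saturate:
  assumes "linked p p'" "same_edge E1 E2 p p'" "linked p q"
  shows "linked p' q"
proof -
  have "certified m n E1 E2 p' q (of_bool (same_edge E1 E2 p q))"
    using assms by (intro certified.saturation[of m n E1 E2 p p' q]) (simp_all only: linked_def of_bool_eq)
  thus ?thesis
    by (simp only: linked_def same_edge_left_cong[OF assms(2)])
qed

lemma RW3plus_if_linked:
  assumes "\<And>p q. p \<in> grid m n \<Longrightarrow> q \<in> grid m n \<Longrightarrow> linked p q"
  shows "RW3plus m n E1 E2"
  using assms by (intro RW3plusI[OF simple]) (simp add: linked_def full)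

end

section \<open>Configurations assembled from blocks\<close>

text \<open>
  A block of consecutive rows without holes, given by the table of its halves: the entry of a cell
  is the other half of its two-edge, and the cell itself for a one-edge. Rows and columns are
  counted from 0 within the block, so that a block can be placed below any other blocks.\<close>

type_synonym block = "cell list list"

definition partner :: "block \<Rightarrow> cell \<Rightarrow> cell" where
  "partner t p = (t ! fst p) ! snd p"

definition block_cells :: "block \<Rightarrow> cell list" where
  "block_cells t = List.product [0..<length t] [0..<5]"

definition valid_block :: "block \<Rightarrow> bool" where
  "valid_block t \<longleftrightarrow> (\<forall>p\<in>set (block_cells t).
     fst (partner t p) < length t \<and> snd (partner t p) < 5 \<and> partner t (partner t p) = p)"

lemma in_block_cells: "p \<in> set (block_cells t) \<longleftrightarrow> fst p < length t \<and> snd p < 5"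
  by (cases p) (auto simp: block_cells_def)

lemma valid_blockD:
  assumes "valid_block t" "p \<in> set (block_cells t)"
  shows "partner t p \<in> set (block_cells t)" "partner t (partner t p) = p"
  using assms by (auto simp: valid_block_def in_block_cells)

text \<open>The blocks are stacked on top of each other; each is paired with the number of rows above it.\<close>

fun layout :: "nat \<Rightarrow> block list \<Rightarrow> (nat \<times> block) list" where
  "layout k [] = []"
| "layout k (t # ts) = (k, t) # layout (k + length t) ts"

abbreviation num_rows :: "block list \<Rightarrow> nat" where
  "num_rows ts \<equiv> sum_list (map length ts)"

lemma map_snd_layout: "map snd (layout k ts) = ts"
  by (induction k ts rule: layout.induct) auto

lemma layout_bounds:
  "(k', t) \<in> set (layout k ts) \<Longrightarrow> t \<in> set ts \<and> k \<le> k' \<and> k' + length t \<le> k + num_rows ts"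
  by (induction k ts rule: layout.induct) fastforce+

lemma layout_cover:
  "k \<le> r \<Longrightarrow> r < k + num_rows ts \<Longrightarrow> \<exists>(k', t)\<in>set (layout k ts). k' \<le> r \<and> r < k' + length t"
proof (induction k ts rule: layout.induct)
  case (2 k t ts)
  thus ?case by (cases "r < k + length t") auto
qed simp

lemma layout_ordered: "sorted_wrt (\<lambda>x y. fst x + length (snd x) \<le> fst y) (layout k ts)"
proof (induction k ts rule: layout.induct)
  case (2 k t ts)
  thus ?case using layout_bounds[of _ _ "k + length t" ts] by auto
qed simp

lemma sorted_wrt_cases:
  "sorted_wrt R xs \<Longrightarrow> x \<in> set xs \<Longrightarrow> y \<in> set xs \<Longrightarrow> x = y \<or> R x y \<or> R y x"
  by (induction xs) auto

lemma layout_unique: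
  assumes "(k1, t1) \<in> set (layout k ts)" "(k2, t2) \<in> set (layout k ts)"
    and "k1 + i = k2 + j" "i < length t1" "j < length t2"
  shows "k1 = k2 \<and> t1 = t2"
  using sorted_wrt_cases[OF layout_ordered assms(1,2)] assms(3-5) by auto

text \<open>The cells of the grid are counted from 1.\<close>

definition place :: "nat \<Rightarrow> cell \<Rightarrow> cell" where
  "place k p = (Suc (k + fst p), Suc (snd p))"

lemma place_inject [simp]: "place k p = place k q \<longleftrightarrow> p = q"
  by (auto simp: place_def prod_eq_iff)

text \<open>For a one-edge the two cells coincide, so one-edges and two-edges are treated alike.\<close>

definition edge_at :: "nat \<Rightarrow> block \<Rightarrow> cell \<Rightarrow> cell set" where
  "edge_at k t p = {place k p, place k (partner t p)}"

definition layout_cells :: "block list \<Rightarrow> (nat \<times> block \<times> cell) set" where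
  "layout_cells ts = {(k, t, p). (k, t) \<in> set (layout 0 ts) \<and> p \<in> set (block_cells t)}"

definition ones :: "block list \<Rightarrow> cell set" where
  "ones ts = {place k p | k t p. (k, t, p) \<in> layout_cells ts \<and> partner t p = p}"

definition twos :: "block list \<Rightarrow> cell set set" where
  "twos ts = {edge_at k t p | k t p. (k, t, p) \<in> layout_cells ts \<and> partner t p \<noteq> p}"

lemma layout_cells_unique:
  assumes "(k, t, p) \<in> layout_cells ts" "(k', t', q) \<in> layout_cells ts" "place k p = place k' q"
  shows "k = k' \<and> t = t' \<and> p = q"
proof -
  have "k = k' \<and> t = t'"
    using assms layout_unique[of k t 0 ts k' t' "fst p" "fst q"]
    by (auto simp: layout_cells_def place_def in_block_cells)
  thus ?thesis using assms(3) by simp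
qed

lemma edge_elements_layout:
  "edge_elements (ones ts) (twos ts) = {edge_at k t p | k t p. (k, t, p) \<in> layout_cells ts}"
proof -
  have "edge_at k t p = {place k p}" if "partner t p = p" for k t p
    using that by (simp add: edge_at_def)
  thus ?thesis
    unfolding edge_elements_def ones_def twos_def by blast
qed

lemma place_in_grid:
  assumes "(k, t, p) \<in> layout_cells ts"
  shows "place k p \<in> grid (num_rows ts) 5"
  using assms layout_bounds[of k t 0 ts]
  by (auto simp: layout_cells_def place_def grid_def in_block_cells)

lemma grid_eq_place:
  assumes "x \<in> grid (num_rows ts) 5"
  shows "\<exists>k t p. (k, t, p) \<in> layout_cells ts \<and> x = place k p"
proof -
  obtain r c where x: "x = (Suc r, Suc c)" "r < num_rows ts" "c < 5"
    using assms by (cases x; cases "fst x"; cases "snd x") (auto simp: grid_def)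
  then obtain k t where "(k, t) \<in> set (layout 0 ts)" "k \<le> r" "r < k + length t"
    using layout_cover[of 0 r ts] by auto
  with x show ?thesis
    by (intro exI[of _ k] exI[of _ t] exI[of _ "(r - k, c)"])
      (auto simp: layout_cells_def place_def in_block_cells)
qed

lemma partner_in_layout_cells:
  assumes "\<forall>t\<in>set ts. valid_block t" "(k, t, p) \<in> layout_cells ts"
  shows "(k, t, partner t p) \<in> layout_cells ts" "partner t (partner t p) = p"
  using assms layout_bounds[of k t 0 ts] valid_blockD[of t p] by (auto simp: layout_cells_def)

lemma edge_at_eqI:
  assumes valid: "\<forall>t\<in>set ts. valid_block t"
    and c: "(k, t, p) \<in> layout_cells ts" "(k', t', q) \<in> layout_cells ts"
    and x: "x \<in> edge_at k t p" "x \<in> edge_at k' t' q"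
  shows "k = k' \<and> t = t' \<and> (q = p \<or> q = partner t p)"
proof -
  obtain p' where p': "p' = p \<or> p' = partner t p" "x = place k p'"
    using x(1) unfolding edge_at_def by blast
  obtain q' where q': "q' = q \<or> q' = partner t' q" "x = place k' q'"
    using x(2) unfolding edge_at_def by blast
  have "(k, t, p') \<in> layout_cells ts" "(k', t', q') \<in> layout_cells ts"
    using p'(1) q'(1) c partner_in_layout_cells(1)[OF valid c(1)]
      partner_in_layout_cells(1)[OF valid c(2)] by metis+
  hence "k = k' \<and> t = t' \<and> p' = q'"
    using layout_cells_unique p'(2) q'(2) by blast
  thus ?thesis
    using p'(1) q'(1) partner_in_layout_cells(2)[OF valid c(1)]
      partner_in_layout_cells(2)[OF valid c(2)] by metis
qed

lemma same_edge_layout: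
  assumes valid: "\<forall>t\<in>set ts. valid_block t"
    and "(k, t, p) \<in> layout_cells ts"
  shows "same_edge (ones ts) (twos ts) (place k p) (place k (partner t p))"
proof -
  have "edge_at k t p \<in> edge_elements (ones ts) (twos ts)"
    unfolding edge_elements_layout using assms(2) by blast
  thus ?thesis
    unfolding same_edge_def by (intro bexI[of _ "edge_at k t p"]) (simp_all add: edge_at_def)
qed

lemma full_config_layout:
  assumes valid: "\<forall>t\<in>set ts. valid_block t" and C4: "C4_free (ones ts)"
  shows "full_config (num_rows ts) 5 (ones ts) (twos ts)"
proof
  let ?E = "edge_elements (ones ts) (twos ts)"
  have sub: "e \<subseteq> grid (num_rows ts) 5" if e: "e \<in> ?E" for e
  proof -
    obtain k t p where "(k, t, p) \<in> layout_cells ts" "e = edge_at k t p"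
      using e unfolding edge_elements_layout by blast
    thus ?thesis
      using place_in_grid[of k t p] place_in_grid[of k t "partner t p"]
        partner_in_layout_cells(1)[OF valid, of k t p] by (simp add: edge_at_def)
  qed
  show "simple_config (num_rows ts) 5 (ones ts) (twos ts)"
    unfolding simple_config_def configuration_def
  proof (intro conjI ballI impI C4)
    show "ones ts \<subseteq> grid (num_rows ts) 5"
      using place_in_grid by (auto simp: ones_def)
    fix e assume e: "e \<in> twos ts"
    thus "e \<subseteq> grid (num_rows ts) 5"
      by (intro sub) (simp add: edge_elements_def)
    show "card e = 2"
      using e by (auto simp: twos_def edge_at_def)
  next
    fix a b assume ab: "a \<in> ?E" "b \<in> ?E" "a \<noteq> b"
    then obtain k t p k' t' q where
      k: "(k, t, p) \<in> layout_cells ts" "a = edge_at k t p"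
         "(k', t', q) \<in> layout_cells ts" "b = edge_at k' t' q"
      unfolding edge_elements_layout by blast
    show "a \<inter> b = {}"
    proof (rule equals0I)
      fix x assume "x \<in> a \<inter> b"
      hence "k = k' \<and> t = t' \<and> (q = p \<or> q = partner t p)"
        using edge_at_eqI[OF valid k(1,3)] k(2,4) by blast
      hence "a = b"
        using k(2,4) partner_in_layout_cells(2)[OF valid k(1)]
        by (elim conjE disjE) (simp_all add: edge_at_def insert_commute)
      with ab show False by blast
    qed
  qed
  show "occupied (ones ts) (twos ts) = grid (num_rows ts) 5"
  proof
    show "occupied (ones ts) (twos ts) \<subseteq> grid (num_rows ts) 5"
      unfolding occupied_Union using sub by blast
    show "grid (num_rows ts) 5 \<subseteq> occupied (ones ts) (twos ts)"
    proof
      fix x assume "x \<in> grid (num_rows ts) 5"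
      then obtain k t p where "(k, t, p) \<in> layout_cells ts" "x = place k p"
        using grid_eq_place by blast
      thus "x \<in> occupied (ones ts) (twos ts)"
        unfolding occupied_Union edge_elements_layout
        by (intro UnionI[of "edge_at k t p"]) (blast, simp add: edge_at_def)
    qed
  qed
qed

section \<open>Checkable derivations\<close>

definition corner :: "cell \<Rightarrow> cell \<Rightarrow> cell" where
  "corner p q = (fst p, snd q)"

text \<open>The flag \<open>same\<close> says that both cells belong to the same placed block. In different blocks equal
  row numbers do not mean equal rows.\<close>

definition collinear :: "bool \<Rightarrow> cell \<Rightarrow> cell \<Rightarrow> bool" where
  "collinear same p q \<longleftrightarrow> snd p = snd q \<or> same \<and> fst p = fst q"

text \<open>A derivation of \<open>linked p q\<close>, read from its end to its start. Each number of the list stands for a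
  saturation step followed by a rectangle step: \<open>p\<close> is replaced by \<open>f p\<close> for 1 and 3, \<open>q\<close> is
  replaced by \<open>g q\<close> for 2 and 3, and then one passes to the other diagonal. The walk ends as soon
  as a collinear pair is reached, where the line rule applies, and returns the unread numbers.
  Therefore the derivations for many pairs can share one list without separators.\<close>

fun walk :: "bool \<Rightarrow> (cell \<Rightarrow> cell) \<Rightarrow> (cell \<Rightarrow> cell) \<Rightarrow> cell \<Rightarrow> cell \<Rightarrow> nat list \<Rightarrow> nat list option" where
  "walk same f g p q [] = (if collinear same p q then Some [] else None)"
| "walk same f g p q (x # xs) =
     (if collinear same p q then Some (x # xs)
      else walk same f g
        (corner (if x = 1 \<or> x = 3 then f p else p) (if x = 2 \<or> x = 3 then g q else q))
        (corner (if x = 2 \<or> x = 3 then g q else q) (if x = 1 \<or> x = 3 then f p else p)) xs)"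

fun walks :: "bool \<Rightarrow> (cell \<Rightarrow> cell) \<Rightarrow> (cell \<Rightarrow> cell) \<Rightarrow> (cell \<times> cell) list \<Rightarrow> nat list option \<Rightarrow> bool" where
  "walks same f g pqs None \<longleftrightarrow> False"
| "walks same f g [] (Some ds) \<longleftrightarrow> True"
| "walks same f g ((p, q) # pqs) (Some ds) \<longleftrightarrow> walks same f g pqs (walk same f g p q ds)"

definition partial_partner :: "block \<Rightarrow> cell list \<Rightarrow> cell \<Rightarrow> cell" where
  "partial_partner t M p = (if p \<in> set M then partner t p else p)"

text \<open>Saturation at a two-edge presupposes that its halves are known to have inner product 1. The list
  of cells \<open>ps\<close> names the two-edges of a block in an order in which this can be derived: the other
  diagonal of the rectangle spanned by the two-edge is either a two-edge as well, which is the
  complementary case, or is treated by a walk that saturates only at the cells \<open>M\<close> of earlier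
  two-edges.\<close>

fun merges :: "block \<Rightarrow> cell list \<Rightarrow> cell list \<Rightarrow> nat list option \<Rightarrow> bool" where
  "merges t M ps None \<longleftrightarrow> False"
| "merges t M [] (Some ds) \<longleftrightarrow> (\<forall>p\<in>set (block_cells t). p \<in> set M \<or> partner t p = p)"
| "merges t M (p # ps) (Some ds) \<longleftrightarrow> p \<in> set (block_cells t) \<and>
     merges t (p # partner t p # M) ps
       (if partner t (corner p (partner t p)) = corner (partner t p) p then Some ds
        else walk True (partial_partner t M) (partial_partner t M)
               (corner p (partner t p)) (corner (partner t p) p) ds)"

text \<open>One cell of each edge element, namely the first in the order of rows.\<close>

definition reps :: "block \<Rightarrow> cell list" where
  "reps t = filter (\<lambda>p. fst p < fst (partner t p) \<or>
     fst p = fst (partner t p) \<and> snd p \<le> snd (partner t p)) (block_cells t)"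

fun pairs :: "'a list \<Rightarrow> ('a \<times> 'a) list" where
  "pairs [] = []"
| "pairs (x # xs) = map (Pair x) xs @ pairs xs"

text \<open>All pairs of cells within the block are linked, by derivations that use this block only.\<close>

definition closed_block :: "block \<Rightarrow> bool" where
  "closed_block t \<longleftrightarrow> valid_block t \<and> (\<exists>ps ds. merges t [] ps (Some ds)) \<and>
     (\<exists>ds. walks True (partner t) (partner t) (pairs (reps t)) (Some ds))"

text \<open>For closed blocks, each cell of a placed copy of \<open>t\<close> is then linked with each cell of a
  different placed block that is a copy of \<open>u\<close>. The derivations use the rows of these two blocks
  only, so compatibility does not depend on where the blocks are placed, and a block may be
  compatible with itself.\<close>

definition compatible :: "block \<Rightarrow> block \<Rightarrow> bool" where
  "compatible t u \<longleftrightarrow>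
     (\<exists>ds. walks False (partner t) (partner u) (List.product (reps t) (reps u)) (Some ds))"

context full_config
begin

text \<open>The pairs at which saturation is permitted.\<close>

definition merged :: "cell \<Rightarrow> cell \<Rightarrow> bool" where
  "merged p p' \<longleftrightarrow> linked p p' \<and> same_edge E1 E2 p p'"

lemma merged_refl: "p \<in> grid m n \<Longrightarrow> merged p p"
  by (simp add: merged_def linked_collinear same_edge_refl full)

lemma merged_grid: "merged p p' \<Longrightarrow> p \<in> grid m n"
  using linked_grid unfolding merged_def by blast

lemma merged_sym: "merged p p' \<Longrightarrow> merged p' p"
  by (simp add: merged_def linked_sym same_edge_sym[of p'])

lemma linked_merged:
  assumes "merged p p'" "merged q q'" "linked p' q'"
  shows "linked p q"
proof -
  have "linked p q'"
    using linked_saturate[of p' p q'] merged_sym[OF assms(1)] assms(3) by (simp add: merged_def)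
  hence "linked q' p"
    by (rule linked_sym)
  thus ?thesis
    using linked_saturate[of q' q p] merged_sym[OF assms(2)] linked_sym by (simp add: merged_def)
qed

text \<open>The rectangle rule and saturation at merged pairs are reversible, so the collinear pair at the
  end of the walk carries its certified value back to the start.\<close>

lemma walk_imp_linked:
  assumes f: "\<And>p. p \<in> set (block_cells t) \<Longrightarrow>
        f p \<in> set (block_cells t) \<and> merged (place k p) (place k (f p))"
    and g: "\<And>q. q \<in> set (block_cells u) \<Longrightarrow>
        g q \<in> set (block_cells u) \<and> merged (place l q) (place l (g q))"
    and same: "same \<Longrightarrow> k = l"
  shows "walk same f g p q xs = Some ys \<Longrightarrow> p \<in> set (block_cells t) \<Longrightarrow> q \<in> set (block_cells u) \<Longrightarrow>
    linked (place k p) (place l q)"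
proof (induction xs arbitrary: p q)
  have collinear: "linked (place k p) (place l q)"
    if "collinear same p q" "p \<in> set (block_cells t)" "q \<in> set (block_cells u)" for p q
  proof (rule linked_collinear)
    show "place k p \<in> grid m n" "place l q \<in> grid m n"
      using f[OF that(2)] g[OF that(3)] merged_grid by blast+
    show "fst (place k p) = fst (place l q) \<or> snd (place k p) = snd (place l q)"
      using that(1) same by (auto simp: collinear_def place_def)
  qed
  {
    case Nil
    thus ?case using collinear by (auto split: if_splits)
  next
    case (Cons x xs)
    show ?case
    proof (cases "collinear same p q")
      case True
      thus ?thesis using collinear Cons.prems by blast
    next
      case False
      define p' where "p' = (if x = 1 \<or> x = 3 then f p else p)"
      define q' where "q' = (if x = 2 \<or> x = 3 then g q else q)"
      have p': "p' \<in> set (block_cells t)" "merged (place k p) (place k p')"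
        using f[OF Cons.prems(2)] Cons.prems(2)
          merged_refl[OF merged_grid[OF conjunct2[OF f[OF Cons.prems(2)]]]] by (simp_all add: p'_def)
      have q': "q' \<in> set (block_cells u)" "merged (place l q) (place l q')"
        using g[OF Cons.prems(3)] Cons.prems(3)
          merged_refl[OF merged_grid[OF conjunct2[OF g[OF Cons.prems(3)]]]] by (simp_all add: q'_def)
      have "walk same f g (corner p' q') (corner q' p') xs = Some ys"
        using Cons.prems(1) False by (simp add: p'_def q'_def)
      hence "linked (place k (corner p' q')) (place l (corner q' p'))"
        using p'(1) q'(1) by (intro Cons.IH) (auto simp: corner_def in_block_cells)
      hence "linked (place k p') (place l q')"
        unfolding place_def corner_def fst_conv snd_conv by (rule linked_rectangle)
      thus ?thesis
        by (rule linked_merged[OF p'(2) q'(2)])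
    qed
  }
qed

end

lemma walks_imp_walk:
  "walks same f g pqs xs \<Longrightarrow> (p, q) \<in> set pqs \<Longrightarrow> \<exists>xs ys. walk same f g p q xs = Some ys"
proof (induction same f g pqs xs rule: walks.induct)
  case (3 same f g p' q' pqs xs)
  show ?case
  proof (cases "(p, q) = (p', q')")
    case True
    thus ?thesis
      using 3(2) by (cases "walk same f g p' q' xs") auto
  next
    case False
    thus ?thesis using 3 by auto
  qed
qed auto

text \<open>Symmetry of \<open>linked\<close> makes one of the two orders of a pair sufficient.\<close>

lemma in_pairs_cases:
  "x \<in> set xs \<Longrightarrow> y \<in> set xs \<Longrightarrow> x = y \<or> (x, y) \<in> set (pairs xs) \<or> (y, x) \<in> set (pairs xs)"
  by (induction xs) auto

lemma reps_cover:
  assumes "valid_block t" "p \<in> set (block_cells t)"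
  shows "\<exists>p'\<in>set (reps t). p' \<in> set (block_cells t) \<and> (p' = p \<or> p' = partner t p)"
proof -
  have "p \<in> set (reps t) \<or> partner t p \<in> set (reps t)"
    using assms(2) valid_blockD[OF assms] by (auto simp: reps_def)
  thus ?thesis
    using assms(2) valid_blockD[OF assms] by blast
qed

locale block_layout =
  fixes ts :: "block list"
  assumes valid: "\<forall>t\<in>set ts. valid_block t" and C4: "C4_free (ones ts)"

sublocale block_layout \<subseteq> full_config "num_rows ts" 5 "ones ts" "twos ts"
  using full_config_layout[OF valid C4] .

context block_layout
begin

lemma layout_valid: "(k, t) \<in> set (layout 0 ts) \<Longrightarrow> valid_block t"
  using valid layout_bounds by blast

lemma place_layout_in_grid:
  assumes "(k, t) \<in> set (layout 0 ts)" "p \<in> set (block_cells t)"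
  shows "place k p \<in> grid (num_rows ts) 5"
  using assms place_in_grid by (simp add: layout_cells_def)

lemma merged_partnerI:
  assumes "(k, t) \<in> set (layout 0 ts)" "p \<in> set (block_cells t)"
    and "linked (place k p) (place k (partner t p))"
  shows "merged (place k p) (place k (partner t p))"
  using assms same_edge_layout[OF valid, of k t p] by (simp add: merged_def layout_cells_def)

lemma merges_imp_merged:
  assumes kt: "(k, t) \<in> set (layout 0 ts)"
  shows "merges t M ps (Some xs) \<Longrightarrow>
    \<forall>p\<in>set M. p \<in> set (block_cells t) \<and> partner t p \<in> set M \<and> merged (place k p) (place k (partner t p)) \<Longrightarrow>
    p \<in> set (block_cells t) \<Longrightarrow> merged (place k p) (place k (partner t p))"
proof (induction ps arbitrary: M xs p)
  case Nil
  hence "p \<in> set M \<or> partner t p = p" by simp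
  thus ?case
    using Nil.prems(2) merged_refl[OF place_layout_in_grid[OF kt Nil.prems(3)]] by auto
next
  case (Cons a ps)
  define b where "b = partner t a"
  define f where "f = partial_partner t M"
  obtain ys where a: "a \<in> set (block_cells t)" and rest: "merges t (a # b # M) ps (Some ys)"
    and step: "partner t (corner a b) = corner b a \<or>
      walk True f f (corner a b) (corner b a) xs = Some ys"
    using Cons.prems(1)
    by (cases "walk True f f (corner a b) (corner b a) xs")
      (auto simp: b_def f_def split: if_splits)
  note ab = valid_blockD[OF layout_valid[OF kt] a, folded b_def]
  have corners: "corner a b \<in> set (block_cells t)" "corner b a \<in> set (block_cells t)"
    using a ab(1) by (auto simp: corner_def in_block_cells)
  have edge: "{place k z, place k (partner t z)} \<in> twos ts"
    if "z \<in> set (block_cells t)" "partner t z \<noteq> z" for z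
  proof -
    have "(k, t, z) \<in> layout_cells ts"
      using that(1) kt by (simp add: layout_cells_def)
    thus ?thesis
      unfolding twos_def edge_at_def using that(2) by blast
  qed
  have "linked (place k a) (place k b)"
    using step
  proof
    assume other: "partner t (corner a b) = corner b a"
    show ?thesis
    proof (cases "fst a = fst b \<or> snd a = snd b")
      case True
      thus ?thesis
        using place_layout_in_grid[OF kt] a ab(1)
        by (intro linked_collinear) (auto simp: place_def)
    next
      case False
      hence "partner t a \<noteq> a" "partner t (corner a b) \<noteq> corner a b"
        unfolding other b_def[symmetric] by (auto simp: corner_def)
      hence "{place k a, place k b} \<in> twos ts"
        and "{place k (corner a b), place k (corner b a)} \<in> twos ts"
        using edge[OF a] edge[OF corners(1)] unfolding other b_def[symmetric] by blast+
      thus ?thesis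
        unfolding place_def corner_def fst_conv snd_conv by (rule linked_complementary)
    qed
  next
    assume w: "walk True f f (corner a b) (corner b a) xs = Some ys"
    have "f z \<in> set (block_cells t) \<and> merged (place k z) (place k (f z))"
      if "z \<in> set (block_cells t)" for z
      using Cons.prems(2) that merged_refl[OF place_layout_in_grid[OF kt that]]
      by (auto simp: f_def partial_partner_def)
    from walk_imp_linked[OF this this _ w corners]
    have "linked (place k (corner a b)) (place k (corner b a))"
      by blast
    thus ?thesis
      unfolding place_def corner_def fst_conv snd_conv by (rule linked_rectangle)
  qed
  hence "merged (place k a) (place k b)"
    unfolding b_def by (rule merged_partnerI[OF kt a])
  hence "\<forall>z\<in>set (a # b # M). z \<in> set (block_cells t) \<and> partner t z \<in> set (a # b # M)
      \<and> merged (place k z) (place k (partner t z))"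
    using Cons.prems(2) a ab merged_sym by (auto simp: b_def[symmetric])
  from Cons.IH[OF rest this Cons.prems(3)] show ?case .
qed

lemma merged_partner:
  assumes "closed_block t" "(k, t) \<in> set (layout 0 ts)" "p \<in> set (block_cells t)"
  shows "merged (place k p) (place k (partner t p))"
proof -
  obtain ps xs where "merges t [] ps (Some xs)"
    using assms(1) by (auto simp: closed_block_def)
  thus ?thesis
    using merges_imp_merged[OF assms(2)] assms(3) by simp
qed

text \<open>After the two-edges have been merged, one cell of each edge element suffices.\<close>

lemma linked_if_reps_linked:
  assumes t: "closed_block t" "(k, t) \<in> set (layout 0 ts)" "p \<in> set (block_cells t)"
    and u: "closed_block u" "(l, u) \<in> set (layout 0 ts)" "q \<in> set (block_cells u)"
    and reps: "\<And>p' q'. p' \<in> set (reps t) \<Longrightarrow> q' \<in> set (reps u) \<Longrightarrow>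
      p' \<in> set (block_cells t) \<Longrightarrow> q' \<in> set (block_cells u) \<Longrightarrow> linked (place k p') (place l q')"
  shows "linked (place k p) (place l q)"
proof -
  obtain p' where p': "p' \<in> set (reps t)" "p' \<in> set (block_cells t)" "p' = p \<or> p' = partner t p"
    using reps_cover[OF layout_valid[OF t(2)] t(3)] by blast
  obtain q' where q': "q' \<in> set (reps u)" "q' \<in> set (block_cells u)" "q' = q \<or> q' = partner u q"
    using reps_cover[OF layout_valid[OF u(2)] u(3)] by blast
  have "merged (place k p) (place k p')"
    using p'(3) merged_partner[OF t] merged_refl[OF place_layout_in_grid[OF t(2,3)]] by blast
  moreover have "merged (place l q) (place l q')"
    using q'(3) merged_partner[OF u] merged_refl[OF place_layout_in_grid[OF u(2,3)]] by blast
  ultimately show ?thesis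
    using linked_merged reps[OF p'(1) q'(1) p'(2) q'(2)] by blast
qed

lemma walk_partner_imp_linked:
  assumes "closed_block t" "(k, t) \<in> set (layout 0 ts)" "closed_block u" "(l, u) \<in> set (layout 0 ts)"
    and "walk same (partner t) (partner u) p q xs = Some ys" "same \<Longrightarrow> k = l"
    and "p \<in> set (block_cells t)" "q \<in> set (block_cells u)"
  shows "linked (place k p) (place l q)"
proof (rule walk_imp_linked[OF _ _ assms(6,5,7,8)])
  show "partner t p \<in> set (block_cells t) \<and> merged (place k p) (place k (partner t p))"
    if "p \<in> set (block_cells t)" for p
    using that valid_blockD(1)[OF layout_valid[OF assms(2)] that] merged_partner[OF assms(1,2) that] by blast
  show "partner u q \<in> set (block_cells u) \<and> merged (place l q) (place l (partner u q))"
    if "q \<in> set (block_cells u)" for q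
    using that valid_blockD(1)[OF layout_valid[OF assms(4)] that] merged_partner[OF assms(3,4) that] by blast
qed

lemma linked_within_block:
  assumes t: "closed_block t" "(k, t) \<in> set (layout 0 ts)"
    and "p \<in> set (block_cells t)" "q \<in> set (block_cells t)"
  shows "linked (place k p) (place k q)"
proof (rule linked_if_reps_linked[OF t assms(3) t assms(4)])
  fix p q assume pq: "p \<in> set (reps t)" "q \<in> set (reps t)"
    "p \<in> set (block_cells t)" "q \<in> set (block_cells t)"
  obtain ds where ds: "walks True (partner t) (partner t) (pairs (reps t)) (Some ds)"
    using t(1) by (auto simp: closed_block_def)
  have walk: "linked (place k a) (place k b)"
    if "(a, b) \<in> set (pairs (reps t))" "a \<in> set (block_cells t)" "b \<in> set (block_cells t)" for a b
    using walks_imp_walk[OF ds that(1)] walk_partner_imp_linked[OF t t _ _ that(2,3)] by blast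
  show "linked (place k p) (place k q)"
    using in_pairs_cases[OF pq(1,2)] walk pq(3,4) linked_sym
      linked_collinear place_layout_in_grid[OF t(2)] by metis
qed

lemma linked_between_blocks:
  assumes t: "closed_block t" "(k, t) \<in> set (layout 0 ts)"
    and u: "closed_block u" "(l, u) \<in> set (layout 0 ts)" and c: "compatible t u"
    and "p \<in> set (block_cells t)" "q \<in> set (block_cells u)"
  shows "linked (place k p) (place l q)"
proof (rule linked_if_reps_linked[OF t assms(6) u assms(7)])
  fix p q assume pq: "p \<in> set (reps t)" "q \<in> set (reps u)"
    "p \<in> set (block_cells t)" "q \<in> set (block_cells u)"
  obtain ds where "walks False (partner t) (partner u) (List.product (reps t) (reps u)) (Some ds)"
    using c by (auto simp: compatible_def)
  hence "\<exists>xs ys. walk False (partner t) (partner u) p q xs = Some ys"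
    using pq by (intro walks_imp_walk) auto
  thus "linked (place k p) (place l q)"
    using walk_partner_imp_linked[OF t u _ _ pq(3,4)] by blast
qed

text \<open>Any two cells lie in at most two blocks, so the pairwise conditions on blocks control stacks of
  arbitrary height.\<close>

theorem RW3plus_layout:
  assumes closed: "\<forall>t\<in>set ts. closed_block t" and compat: "sorted_wrt compatible ts"
  shows "RW3plus (num_rows ts) 5 (ones ts) (twos ts)"
proof (rule RW3plus_if_linked)
  fix x y assume "x \<in> grid (num_rows ts) 5" "y \<in> grid (num_rows ts) 5"
  then obtain k t p l u q where
    x: "(k, t) \<in> set (layout 0 ts)" "p \<in> set (block_cells t)" "x = place k p" and
    y: "(l, u) \<in> set (layout 0 ts)" "q \<in> set (block_cells u)" "y = place l q"
    using grid_eq_place[of x ts] grid_eq_place[of y ts] unfolding layout_cells_def by blast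
  have cl: "closed_block t" "closed_block u"
    using closed x(1) y(1) layout_bounds by blast+
  have "sorted_wrt (\<lambda>a b. compatible (snd a) (snd b)) (layout 0 ts)"
    using compat by (simp only: sorted_wrt_map[symmetric] map_snd_layout)
  from sorted_wrt_cases[OF this x(1) y(1)]
  consider "(k, t) = (l, u)" | "compatible t u" | "compatible u t"
    by auto
  thus "linked x y"
  proof cases
    case 1
    thus ?thesis using linked_within_block[OF cl(1) x(1)] x y by simp
  next
    case 2
    thus ?thesis using linked_between_blocks[OF cl(1) x(1) cl(2) y(1)] x y by simp
  next
    case 3
    thus ?thesis using linked_between_blocks[OF cl(2) y(1) cl(1) x(1)] x y linked_sym by simp
  qed
qed

end

section \<open>Counting one-edges\<close>

definition fixed_cells :: "block \<Rightarrow> cell list" where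
  "fixed_cells t = filter (\<lambda>p. partner t p = p) (block_cells t)"

lemma ones_eq_UN: "ones ts = (\<Union>(k, t)\<in>set (layout 0 ts). place k ` set (fixed_cells t))"
  unfolding ones_def layout_cells_def fixed_cells_def by fastforce

lemma distinct_fixed_cells: "distinct (fixed_cells t)"
  by (simp add: fixed_cells_def block_cells_def distinct_product)

lemma distinct_layout: "[] \<notin> set ts \<Longrightarrow> distinct (layout k ts)"
proof (induction k ts rule: layout.induct)
  case (2 k t ts)
  thus ?case using layout_bounds[of k t "k + length t" ts] by auto
qed simp

lemma card_ones:
  assumes "[] \<notin> set ts"
  shows "card (ones ts) = (\<Sum>t\<leftarrow>ts. length (fixed_cells t))"
proof -
  define S where "S x = place (fst x) ` set (fixed_cells (snd x))" for x
  have "card (ones ts) = card (\<Union>x\<in>set (layout 0 ts). S x)"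
    by (simp add: ones_eq_UN S_def case_prod_unfold)
  also have "\<dots> = (\<Sum>x\<in>set (layout 0 ts). card (S x))"
  proof (rule card_UN_disjoint)
    show "\<forall>x\<in>set (layout 0 ts). \<forall>y\<in>set (layout 0 ts). x \<noteq> y \<longrightarrow> S x \<inter> S y = {}"
    proof (intro ballI impI equals0I)
      fix x y z assume xy: "x \<in> set (layout 0 ts)" "y \<in> set (layout 0 ts)" "x \<noteq> y" "z \<in> S x \<inter> S y"
      then obtain p q where "p \<in> set (fixed_cells (snd x))" "q \<in> set (fixed_cells (snd y))"
        "place (fst x) p = place (fst y) q"
        unfolding S_def by blast
      hence "fst x = fst y \<and> snd x = snd y \<and> p = q"
        using xy by (intro layout_cells_unique[of _ _ _ ts]) (auto simp: layout_cells_def fixed_cells_def)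
      with xy(3) show False by (simp add: prod_eq_iff)
    qed
  qed (auto simp: S_def)
  also have "\<dots> = (\<Sum>x\<in>set (layout 0 ts). length (fixed_cells (snd x)))"
    unfolding S_def using distinct_fixed_cells
    by (intro sum.cong refl) (simp add: card_image inj_on_def distinct_card)
  also have "\<dots> = sum_list (map (\<lambda>x. length (fixed_cells (snd x))) (layout 0 ts))"
    by (rule sum.distinct_set_conv_list[OF distinct_layout[OF assms]])
  also have "\<dots> = (\<Sum>t\<leftarrow>map snd (layout 0 ts). length (fixed_cells t))"
    by (simp add: comp_def)
  finally show ?thesis
    by (simp only: map_snd_layout)
qed

definition one_per_row :: "block \<Rightarrow> bool" where
  "one_per_row t \<longleftrightarrow>
     (\<forall>p\<in>set (fixed_cells t). \<forall>q\<in>set (fixed_cells t). fst p = fst q \<longrightarrow> p = q)"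

text \<open>The cells \<open>p, q, x, y\<close> are the corners of a rectangle.\<close>

definition C4_free_block :: "block \<Rightarrow> bool" where
  "C4_free_block t \<longleftrightarrow>
     (\<forall>p\<in>set (fixed_cells t). \<forall>q\<in>set (fixed_cells t). fst p = fst q \<and> p \<noteq> q \<longrightarrow>
       (\<forall>x\<in>set (fixed_cells t). snd x = snd p \<and> fst x \<noteq> fst p \<longrightarrow>
         (\<forall>y\<in>set (fixed_cells t). \<not> (fst y = fst x \<and> snd y = snd q))))"

text \<open>A rectangle needs two rows with at least two one-edges, and these occur only in the first block.\<close>

lemma C4_free_ones:
  assumes t: "C4_free_block t" and ts: "\<forall>u\<in>set ts. one_per_row u"
  shows "C4_free (ones (t # ts))"
proof -
  have two: "\<exists>p q. p \<in> set (fixed_cells t) \<and> q \<in> set (fixed_cells t) \<and> (r, c) = place 0 p \<and> (r, d) = place 0 q"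
    if rc: "(r, c) \<in> ones (t # ts)" "(r, d) \<in> ones (t # ts)" "c \<noteq> d" for r c d
  proof -
    obtain k u p where p: "(k, u) \<in> set (layout 0 (t # ts))" "p \<in> set (fixed_cells u)" "(r, c) = place k p"
      using rc(1) unfolding ones_eq_UN by blast
    obtain l v q where q: "(l, v) \<in> set (layout 0 (t # ts))" "q \<in> set (fixed_cells v)" "(r, d) = place l q"
      using rc(2) unfolding ones_eq_UN by blast
    have rows: "fst p < length u" "fst q < length v"
      using p(2) q(2) by (simp_all add: fixed_cells_def in_block_cells)
    hence same: "l = k" "v = u"
      using layout_unique[OF p(1) q(1), of "fst p" "fst q"] p(3) q(3) by (auto simp: place_def)
    have "fst p = fst q" "p \<noteq> q"
      using p(3) q(3) same rc(3) by (auto simp: place_def)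
    hence "\<not> one_per_row u"
      using p(2) q(2) same unfolding one_per_row_def by blast
    hence "u \<notin> set ts"
      using ts by blast
    hence "k = 0 \<and> u = t"
      using p(1) layout_bounds[of k u "length t" ts] by auto
    thus ?thesis
      using p q same by blast
  qed
  show ?thesis
    unfolding C4_free_def
  proof (intro notI, elim exE conjE)
    fix r s c d
    assume rs: "r \<noteq> s" "c \<noteq> d" "(r, c) \<in> ones (t # ts)" "(r, d) \<in> ones (t # ts)"
      "(s, c) \<in> ones (t # ts)" "(s, d) \<in> ones (t # ts)"
    obtain p q where pq: "p \<in> set (fixed_cells t)" "q \<in> set (fixed_cells t)"
      "(r, c) = place 0 p" "(r, d) = place 0 q"
      using two[OF rs(3,4,2)] by blast
    obtain x y where xy: "x \<in> set (fixed_cells t)" "y \<in> set (fixed_cells t)"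
      "(s, c) = place 0 x" "(s, d) = place 0 y"
      using two[OF rs(5,6,2)] by blast
    have "fst p = fst q" "p \<noteq> q" "snd x = snd p" "fst x \<noteq> fst p" "fst y = fst x" "snd y = snd q"
      using pq(3,4) xy(3,4) rs(1,2) by (auto simp: place_def)
    thus False
      using t pq(1,2) xy(1,2) unfolding C4_free_block_def by blast
  qed
qed

section \<open>Blocks for all numbers of rows\<close>

text \<open>The first ten rows have two one-edges each, one row for every pair of columns; all other rows,
  in this and the following blocks, have a single one-edge. Thus a stack with the first block at
  the top and \<open>m\<close> rows has \<open>m + 10\<close> one-edges, and all remaining cells are halves. The positions
  of the halves follow no further pattern; they matter only in that the checks below succeed.\<close>

definition core :: block where
  "core =
    [[(0,0), (0,1), (4,3), (11,4), (3,3)],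
     [(1,0), (8,3), (1,2), (8,1), (11,3)],
     [(2,0), (11,2), (11,1), (2,3), (10,2)],
     [(3,0), (8,0), (9,1), (0,4), (3,4)],
     [(5,4), (4,1), (4,2), (0,2), (5,0)],
     [(4,4), (5,1), (10,0), (5,3), (4,0)],
     [(7,0), (6,1), (6,3), (6,2), (6,4)],
     [(6,0), (10,4), (7,2), (7,3), (10,1)],
     [(3,1), (1,3), (8,2), (1,1), (8,4)],
     [(9,2), (3,2), (9,0), (9,3), (9,4)],
     [(5,2), (7,4), (2,4), (10,3), (7,1)],
     [(11,0), (2,2), (2,1), (1,4), (0,3)]]"

definition tailA :: block where
  "tailA =
    [[(0,1), (0,0), (0,4), (0,3), (0,2)]]"

definition tailB :: block where
  "tailB =
    [[(1,3), (0,1), (0,4), (1,0), (0,2)],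
     [(0,3), (1,4), (1,2), (0,0), (1,1)]]"

text \<open>Being compatible with itself, this block can be repeated.\<close>

definition period :: block where
  "period =
    [[(3,0), (2,3), (1,3), (2,1), (0,4)],
     [(1,0), (3,4), (2,4), (0,2), (3,1)],
     [(3,3), (0,3), (2,2), (0,1), (1,2)],
     [(0,0), (1,4), (3,2), (2,0), (1,1)]]"

text \<open>The first list is the order of the two-edges, the others are the concatenated walks.\<close>

lemma closed_tailA: "closed_block tailA"
proof -
  have "valid_block tailA"
    by code_simp
  moreover have "merges tailA [] [(0,0), (0,2)]
    (Some [])"
    by code_simp
  moreover have "walks True (partner tailA) (partner tailA) (pairs (reps tailA)) (Some
    [])"
    by code_simp
  ultimately show ?thesis
    unfolding closed_block_def by blast
qed

lemma closed_tailB: "closed_block tailB"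
proof -
  have "valid_block tailB"
    by code_simp
  moreover have "merges tailB [] [(0,0), (0,2), (0,3), (1,1)]
    (Some [])"
    by code_simp
  moreover have "walks True (partner tailB) (partner tailB) (pairs (reps tailB)) (Some
    [1, 1, 0, 3, 3, 1, 1])"
    by code_simp
  ultimately show ?thesis
    unfolding closed_block_def by blast
qed

lemma closed_period: "closed_block period"
proof -
  have "valid_block period"
    by code_simp
  moreover have "merges period [] [(0,0), (0,1), (0,3), (1,1), (1,4), (2,0), (1,2), (0,2)]
    (Some [3, 1, 2, 1, 2, 1, 3])"
    by code_simp
  moreover have "walks True (partner period) (partner period) (pairs (reps period)) (Some
    [3, 0, 1, 3, 0, 3, 1, 0, 3, 3, 2, 1, 1, 0, 3, 1, 1, 1, 3, 0, 2, 1, 3, 3, 2, 1, 0, 1, 0, 3, 2, 2,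
     2, 3, 0, 2, 0, 3, 0, 1, 0, 2, 2, 3, 0, 1, 1, 1, 3, 0, 2, 1, 1])"
    by code_simp
  ultimately show ?thesis
    unfolding closed_block_def by blast
qed

lemma closed_core: "closed_block core"
proof -
  have "valid_block core"
    by code_simp
  moreover have "merges core [] [(1,1), (1,3), (2,1), (2,2), (4,0), (4,4), (6,0), (6,2), (7,1), (7,4), (9,0), (2,4), (5,2),
     (1,4), (0,3), (0,4), (0,2), (3,1), (3,2)]
    (Some [3, 3, 1, 2, 2, 2, 1, 1, 2, 2, 2, 1, 2, 1, 3])"
    by code_simp
  moreover have "walks True (partner core) (partner core) (pairs (reps core)) (Some
    [2, 2, 2, 0, 1, 2, 2, 2, 2, 2, 1, 2, 1, 3, 0, 1, 1, 2, 1, 0, 1, 2, 2, 2, 2, 2, 2, 2, 2, 0, 1, 0,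
     2, 1, 1, 3, 1, 3, 0, 1, 2, 0, 2, 1, 2, 1, 2, 0, 3, 0, 2, 2, 2, 3, 2, 3, 2, 3, 0, 1, 2, 1, 1, 1,
     2, 2, 3, 0, 3, 3, 1, 3, 0, 1, 2, 3, 0, 3, 2, 1, 1, 1, 0, 2, 2, 0, 3, 0, 2, 1, 0, 3, 1, 0, 2, 1,
     0, 2, 2, 2, 0, 3, 2, 0, 3, 0, 2, 1, 3, 2, 0, 3, 0, 2, 2, 0, 2, 2, 0, 1, 2, 1, 1, 3, 1, 3, 0, 1,
     0, 1, 2, 1, 2, 2, 3, 2, 1, 1, 1, 0, 1, 1, 1, 2, 2, 2, 3, 2, 1, 1, 1, 0, 1, 2, 1, 0, 2, 2, 0, 3,
     2, 0, 3, 0, 3, 2, 2, 0, 2, 2, 0, 3, 0, 3, 0, 2, 1, 1, 2, 1, 1, 2, 2, 3, 1, 3, 1, 1, 2, 1, 2, 1,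
     2, 1, 3, 0, 2, 0, 1, 1, 1, 1, 0, 2, 2, 3, 2, 1, 1, 1, 1, 1, 3, 1, 3, 0, 2, 1, 1, 1, 0, 3, 2, 2,
     1, 2, 2, 2, 2, 0, 1, 3, 2, 1, 0, 1, 1, 1, 1, 3, 1, 2, 2, 0, 1, 2, 1, 2, 2, 3, 3, 1, 0, 2, 0, 2,
     0, 2, 1, 3, 0, 2, 0, 2, 1, 1, 1, 1, 0, 1, 3, 2, 3, 1, 1, 1, 2, 1, 3, 1, 3, 1, 0, 1, 1, 2, 1, 1,
     1, 1, 2, 2, 3, 0, 3, 1, 0, 2, 2, 2, 2, 2, 2, 1, 1, 1, 1, 2, 1, 2, 1, 1, 2, 1, 1, 3, 1, 3, 0, 3,
     1, 1, 2, 1, 1, 1, 1, 2, 1, 3, 2, 0, 2, 2, 2, 2, 1, 1, 3, 3, 1, 1, 1, 0, 2, 0, 1, 1, 3, 2, 2, 1,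
     1, 1, 2, 0, 1, 1, 2, 2, 2, 2, 2, 2, 0, 1, 2, 1, 0, 1, 3, 1, 0, 2, 2, 2, 1, 1, 3, 2, 0, 2, 1, 3,
     2, 0, 1, 1, 0, 3, 1, 3, 2, 1, 1, 0, 2, 2, 1, 1, 3, 0, 1, 1, 3, 0, 2, 2, 1, 1, 0, 3, 1, 2, 1, 1,
     3, 0, 2, 2, 0, 3, 2, 1, 0, 1, 3, 0, 3, 1, 2, 3, 1, 0, 1, 1, 1, 1, 3, 2, 2, 1, 0, 3, 0, 2, 2, 1,
     2, 1, 3, 1, 1, 2, 0, 1, 3, 3, 1, 3, 1, 3, 1, 3, 3, 0, 1, 3, 0, 2, 2, 1, 2, 1, 1, 2, 2, 1, 0, 3,
     2, 1, 1, 1, 1, 1, 2, 0, 2, 1, 1, 1, 2, 2, 0, 3, 2, 0, 2, 2, 2, 0, 2, 0, 1, 2, 1, 2, 2, 2, 1, 1,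
     3, 0, 1, 2, 2, 2, 0, 3, 1, 3, 0, 3, 1, 0, 2, 1, 1, 0, 3, 0, 3, 2, 2, 0, 1, 2, 2, 2, 2, 3, 0, 1,
     3, 2, 0, 3, 3, 0, 1, 1, 2, 3, 1, 0, 2, 1, 0, 2, 1, 1, 3, 2, 1, 1, 1, 3, 0, 1, 1, 1, 1, 3, 0, 2,
     1, 1, 1, 0, 2, 3, 1, 1, 3, 1, 1, 1, 1, 2, 0, 1, 1, 1, 2, 2, 3, 1, 1, 1, 3, 0, 1, 0, 2, 0, 2, 2,
     3, 3, 1, 1, 2, 1, 1, 2, 1, 1, 2, 1, 2, 1, 3, 1, 2, 0, 3, 3, 1, 2, 2, 1, 1, 3, 1, 2, 2, 1, 1, 3,
     1, 3, 3, 2, 1, 1, 2, 1, 1, 1, 3, 3, 1, 2, 3, 1, 1, 1, 1, 2, 2, 3, 0, 1, 1, 0, 3, 1, 1, 0, 2, 1,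
     2, 0, 1, 2, 2, 0, 2, 3, 0, 2, 2, 3, 0, 3, 2, 3, 1, 0, 1, 1, 2, 3, 0, 1, 2, 3, 1, 0, 2, 2, 3, 2,
     3, 1, 2, 3, 0, 3, 0, 1, 1, 0, 2, 1, 2, 2, 1, 0, 3, 0, 2, 1, 1, 3, 3, 1, 0, 2, 2, 1, 1, 2, 3, 1,
     1, 1, 3, 2, 1, 1, 3, 2, 1, 1, 3, 2, 2, 3, 1, 1, 3, 1, 0, 2, 1, 2, 1, 0, 2, 2, 3, 0, 2, 3, 1, 0,
     3, 1, 3, 1, 1, 2, 1, 0, 1, 2, 1, 1, 2, 2, 1, 1, 1, 3, 3, 1, 3, 2, 3, 1, 1, 0, 1, 1, 1, 3, 3, 1,
     3, 2, 1, 2, 2, 1, 0, 1, 1, 3, 1, 0, 2, 1, 1, 0, 3, 1, 0, 3, 1, 0, 2, 2, 1, 2, 0, 3, 0, 2, 0, 3,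
     0, 1, 3, 2, 1, 1, 3, 0, 1, 1, 3, 3, 1, 0, 2, 3, 2, 3, 1, 0, 3, 2, 0, 3, 2, 1, 0, 1, 3, 2, 1, 3,
     0, 3, 0, 2, 3, 2, 1, 2, 2, 1, 0, 1, 2, 1, 2, 1, 1, 1, 1, 0, 2, 1, 1, 1, 1, 3, 1, 1, 2, 0, 3, 2,
     1, 1, 2, 1, 1, 2, 1, 1, 0, 1, 3, 1, 2, 1, 0, 2, 1, 3, 1, 3, 1, 2, 1, 2, 1, 1, 1, 1, 1, 1, 1, 0,
     1, 0, 1, 1, 1, 2, 0, 1, 2, 0, 3, 0, 1, 0, 1, 1, 1, 0, 2, 2, 1, 0, 3, 0, 3, 1, 1, 0, 2, 2, 1, 1,
     1, 2, 1, 0, 2, 0, 2, 0, 2, 1, 0, 2, 1, 0, 3, 3, 1, 0, 1, 3, 3, 1, 3, 1, 3, 1, 0, 1, 1, 2, 3, 0,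
     1, 0, 3, 2, 1, 1, 1, 0, 2, 0, 2, 0, 3, 1, 1, 1, 1, 1, 2, 2, 1, 0, 1, 3, 1, 1, 1, 1, 0, 2, 1, 1,
     0, 1, 2, 2, 2, 2, 3, 1, 2, 2, 2, 1, 1, 0, 3, 1, 3, 2, 0, 3, 0, 2, 2, 0, 3, 2, 2, 3, 0, 1, 2, 2,
     1, 0, 1, 2, 3, 2, 1, 2, 0, 3, 0, 1, 0, 1, 2, 2, 2, 1, 0, 1, 0, 1, 0, 2, 1, 1, 2, 1, 0, 2, 3, 1,
     1, 3, 1, 3, 1, 3, 0, 2, 3, 1, 3, 1, 0, 2, 2, 1, 0, 3, 1, 0, 3, 2, 3, 0, 1, 2, 2, 3, 2, 1, 1, 1,
     2, 3, 2, 1, 2, 1, 1, 1, 0, 1, 2, 3, 0, 2, 2, 0, 3, 2, 2, 0, 2, 1, 0, 2, 2, 2, 2, 0, 3, 0, 3, 1,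
     0, 1, 2, 2, 2, 0, 3, 2, 0, 2, 3, 0, 1, 2, 1, 3, 0, 2, 1, 2, 1, 1, 1, 0, 1, 1, 2, 2, 0, 1, 0, 1,
     3, 0, 1, 1, 2, 0, 1, 0, 3, 0, 1, 0, 1, 2, 2, 1, 1, 1, 1, 1, 2, 3, 1, 1, 2, 1, 3, 1, 2, 2, 1, 1,
     1, 1, 0, 1, 1, 1, 1, 2, 1, 2, 3, 0, 1, 3, 0, 1, 2, 3, 0, 3, 0, 2, 1, 3, 2, 0, 1, 2, 0, 1, 2, 2,
     2, 0, 2, 2, 3, 0, 1, 2, 2, 0, 2, 1, 2, 3, 1, 3, 0, 3, 2, 1, 1, 3, 1, 3, 3, 1, 2, 3, 3, 1, 3, 2,
     0, 2, 1, 1, 1, 1, 0, 3, 1, 1, 0, 2, 1, 0, 2, 1, 3, 2, 0, 2, 1, 3, 2, 1, 3, 0, 1, 2, 3, 0, 1, 2,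
     3, 1, 3, 0, 1, 2, 3, 0, 1, 3, 2, 0, 1, 1, 1, 1, 0, 1, 3, 0, 3, 1, 1, 1, 1, 0, 2, 2, 1, 3, 0, 3,
     1, 1, 3, 0, 3, 0, 2, 2, 0, 3, 2, 2, 0, 3, 0, 2, 2, 2, 2, 0, 3, 0, 2, 1, 2, 0, 1, 2, 2, 3, 0, 1,
     1, 3, 2, 2, 2, 1, 2, 2, 2, 3, 1, 2, 2, 3, 2, 1, 0, 2, 1, 1, 3, 1, 0, 3, 1, 3, 2, 0, 2, 2, 2, 3,
     0, 3, 2, 2, 3, 0, 1, 2, 2, 3, 0, 1, 1, 3, 0, 1, 2, 1, 1, 3, 0, 1, 2, 0, 1, 1, 3, 1, 1, 1, 3, 1,
     0, 2, 2, 1, 1, 1, 1, 1, 1, 1, 3, 2, 0, 1, 3, 2, 2, 0, 2, 1, 3, 0, 3, 3, 0, 2, 1, 2, 3, 0, 2, 1,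
     3, 0, 2, 1, 1, 0, 3, 0, 1, 3, 0, 1, 2, 3, 0, 1, 1, 3, 1, 3, 1, 3, 2, 1, 3, 1, 2, 3, 1, 1, 3, 2,
     0, 1, 2, 0, 2, 1, 2, 0, 3, 3, 0, 3, 0, 1, 2, 0, 1, 3, 2, 1, 0, 3, 0, 3, 1, 0, 2, 1, 2, 2, 2, 2,
     0, 1, 2, 1, 3, 2, 0, 2, 1, 1, 2, 2, 2, 2, 0, 3, 2, 0, 2, 1, 3, 3, 2])"
    by code_simp
  ultimately show ?thesis
    unfolding closed_block_def by blast
qed

lemma compatible_core_tailA: "compatible core tailA"
proof -
  have "walks False (partner core) (partner tailA) (List.product (reps core) (reps tailA)) (Some
    [2, 3, 1, 3, 0, 3, 3, 2, 2, 1, 1, 3, 0, 1, 3, 2, 2, 1, 1, 3, 1, 3, 3, 3, 3, 1, 3, 2, 1, 2, 3, 1,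
     2, 1, 2, 1, 2, 1, 1, 3, 3, 0, 3, 2, 2, 1, 1, 2, 1, 2, 1, 2, 1, 1, 3, 3, 1, 2, 2, 1, 1, 2, 1, 2,
     1, 2, 1, 1, 3, 3, 0, 2, 1, 3, 2, 1, 3, 1, 2, 1, 2, 1, 2, 1, 1, 3, 3, 2, 1, 0, 3, 0, 2, 1, 3, 2,
     1, 1, 3, 3, 0, 2, 1, 2, 1, 2, 1, 1, 3, 3, 2, 1, 3, 2, 1, 2, 1, 2, 1, 1, 3, 3, 1, 1, 2, 1, 2, 1,
     2, 1, 1, 3, 3, 0, 3, 0, 2, 1, 3, 2, 0, 1, 1, 3, 3, 0, 3, 2, 2, 1, 2, 0, 1, 3, 0, 3, 2, 1, 1, 3,
     2, 2, 3, 0, 1, 2, 1, 1, 3, 0, 3, 0, 1, 1, 2, 0, 3, 2, 2, 3, 0, 2, 1, 3, 1, 0, 2, 1, 3, 2, 1, 1,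
     3, 0, 1, 3, 2, 1, 3, 2, 1, 1, 3, 3, 3, 0, 1, 3, 3, 2, 2, 2, 1, 3, 0, 3, 3, 3, 0, 3, 3, 1, 0, 1,
     3, 2, 0, 3, 2, 3, 0, 2, 1, 1, 3, 3, 2, 3, 0, 2, 1, 2, 1, 2, 1, 3, 2, 1, 1, 3, 0, 1, 1, 3, 3, 2,
     1, 2, 1, 2, 1, 3, 2, 1, 1, 3, 3, 2, 1, 2, 1, 2, 1, 3, 2, 1, 1, 3, 0, 1, 1, 0, 3, 1, 1, 2, 1, 2,
     1, 2, 1, 1, 3, 3, 0, 3, 1, 2, 0, 1, 1, 1, 2, 1, 2, 1, 2, 1, 1, 3, 3, 1, 0, 2, 1, 3, 2, 1, 3, 0,
     1, 2, 1, 3, 2, 3, 2, 0, 2, 1, 2, 1, 3, 0, 1, 2, 1, 3, 2, 1, 1, 3, 2, 1, 2, 1, 1, 3, 3, 0, 3, 0,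
     2, 1, 2, 1, 2, 1, 2, 1, 1, 3, 3])"
    by code_simp
  thus ?thesis
    unfolding compatible_def by blast
qed

lemma compatible_core_tailB: "compatible core tailB"
proof -
  have "walks False (partner core) (partner tailB) (List.product (reps core) (reps tailB)) (Some
    [0, 2, 3, 2, 3, 2, 2, 3, 0, 3, 2, 3, 2, 1, 3, 0, 1, 3, 0, 3, 3, 3, 1, 2, 3, 1, 3, 3, 2, 1, 3, 3,
     3, 1, 3, 3, 1, 3, 2, 1, 2, 0, 1, 3, 0, 3, 2, 3, 2, 0, 3, 0, 2, 2, 1, 3, 3, 2, 3, 1, 1, 2, 1, 1,
     0, 2, 3, 0, 3, 2, 3, 0, 2, 1, 2, 1, 2, 2, 3, 2, 1, 2, 1, 1, 0, 2, 2, 3, 3, 1, 2, 2, 3, 2, 1, 2,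
     1, 2, 2, 3, 0, 1, 2, 3, 0, 3, 3, 2, 0, 3, 3, 0, 1, 2, 3, 1, 2, 3, 1, 1, 3, 1, 3, 3, 1, 3, 2, 3,
     1, 2, 0, 1, 3, 2, 3, 1, 2, 3, 1, 0, 1, 3, 1, 1, 1, 3, 2, 3, 1, 2, 1, 0, 1, 2, 2, 1, 2, 0, 1, 0,
     2, 3, 1, 0, 1, 3, 0, 1, 1, 1, 1, 1, 0, 3, 1, 2, 1, 0, 2, 1, 2, 0, 1, 2, 0, 3, 0, 2, 2, 3, 3, 2,
     3, 0, 2, 1, 2, 2, 3, 2, 1, 2, 2, 3, 2, 3, 0, 2, 1, 1, 2, 1, 0, 2, 1, 2, 2, 3, 0, 1, 2, 1, 1, 1,
     1, 2, 2, 3, 2, 3, 2, 1, 1, 2, 2, 3, 2, 1, 2, 2, 3, 2, 3, 0, 2, 1, 2, 1, 1, 1, 1, 3, 3, 3, 2, 1,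
     2, 1, 2, 0, 2, 3, 2, 3, 2, 3, 0, 3, 1, 1, 3, 0, 3, 2, 2, 2, 3, 0, 3, 0, 1, 1, 3, 0, 1, 2, 2, 2,
     3, 2, 2, 2, 3, 0, 3, 2, 2, 3, 3, 1, 2, 2, 2, 3, 1, 3, 2, 2, 3, 0, 2, 3, 0, 2, 1, 2, 2, 2, 3, 2,
     0, 3, 2, 0, 1, 2, 2, 3, 1, 3, 3, 1, 2, 2, 1, 1, 1, 0, 1, 3, 0, 3, 2, 1, 3, 0, 1, 1, 2, 0, 1, 2,
     2, 1, 0, 2, 1, 3, 0, 3, 3, 0, 2, 1, 3, 0, 3, 3, 1, 2, 2, 1, 2, 3, 2, 1, 3, 0, 1, 1, 0, 3, 1, 2,
     1, 1, 0, 1, 2, 2, 3, 2, 3, 0, 1, 1, 2, 2, 3, 2, 0, 2, 1, 2, 2, 3, 1, 1, 1, 2, 1, 1, 1, 2, 0, 1,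
     3, 0, 3, 2, 2, 3, 0, 3, 0, 3, 0, 3, 2, 2, 3, 1, 2, 0, 2, 1, 2, 0, 3, 1, 2, 3, 0, 2, 1, 2, 2, 3,
     0, 2, 1, 0, 2, 3, 2, 3, 2, 2, 3, 0, 2, 3])"
    by code_simp
  thus ?thesis
    unfolding compatible_def by blast
qed

lemma compatible_tailA_tailB: "compatible tailA tailB"
proof -
  have "walks False (partner tailA) (partner tailB) (List.product (reps tailA) (reps tailB)) (Some
    [1, 2, 2, 2, 3, 2, 1, 1, 3, 3, 2, 3, 1, 1, 2, 2, 3, 3, 3, 3, 2, 0, 3, 2, 2, 3, 0, 3, 0, 1, 2, 3])"
    by code_simp
  thus ?thesis
    unfolding compatible_def by blast
qed

lemma compatible_tailA_period: "compatible tailA period"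
proof -
  have "walks False (partner tailA) (partner period) (List.product (reps tailA) (reps period)) (Some
    [1, 0, 3, 3, 3, 0, 2, 3, 1, 1, 3, 3, 1, 2, 2, 1, 3, 3, 3, 3, 2, 2, 0, 2, 1, 1, 3, 3, 1, 1, 3, 3,
     2, 2, 2, 2, 0, 1, 2, 0, 2, 3, 3, 0, 3, 3, 3, 0, 2, 2, 3, 2, 0, 1, 2, 2, 0, 3, 3, 3])"
    by code_simp
  thus ?thesis
    unfolding compatible_def by blast
qed

lemma compatible_tailB_period: "compatible tailB period"
proof -
  have "walks False (partner tailB) (partner period) (List.product (reps tailB) (reps period)) (Some
    [3, 3, 1, 1, 3, 3, 3, 3, 3, 3, 3, 2, 3, 0, 1, 1, 3, 0, 2, 3, 0, 3, 0, 3, 2, 2, 2, 0, 2, 2, 2, 0,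
     3, 3, 3, 0, 3, 2, 0, 3, 0, 2, 2, 0, 3, 0, 3, 3, 2, 2, 0, 2, 1, 0, 3, 3, 3, 1, 1, 1, 3, 1, 2, 2,
     0, 1, 2, 1, 3, 3, 3, 0, 2, 0, 3, 2, 0, 1, 2, 2, 1, 2, 3, 0, 3, 3, 2, 2, 3, 2, 1, 1, 1, 3, 3, 2,
     0, 3, 1, 2, 0, 2, 2, 0, 3, 0, 3, 2, 2, 3, 0, 2, 0, 2, 2, 2, 3, 0, 1, 2, 0, 3, 0, 2, 2, 1, 2, 3])"
    by code_simp
  thus ?thesis
    unfolding compatible_def by blast
qed

lemma compatible_period_period: "compatible period period"
proof -
  have "walks False (partner period) (partner period) (List.product (reps period) (reps period)) (Some
    [2, 2, 3, 1, 1, 1, 1, 1, 2, 2, 0, 1, 1, 2, 2, 3, 2, 1, 2, 0, 3, 0, 1, 2, 3, 2, 3, 2, 1, 1, 1, 1,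
     1, 1, 2, 2, 3, 0, 3, 0, 2, 2, 3, 2, 3, 1, 1, 3, 0, 2, 2, 3, 0, 1, 2, 0, 2, 3, 2, 2, 2, 2, 1, 3,
     1, 0, 1, 1, 1, 0, 2, 3, 2, 0, 1, 0, 1, 2, 2, 1, 1, 2, 2, 2, 2, 3, 2, 3, 2, 0, 2, 1, 2, 2, 2, 2,
     3, 0, 2, 0, 2, 1, 2, 2, 2, 0, 1, 1, 3, 0, 2, 2, 0, 1, 3, 2, 2, 3, 3, 2, 2, 1, 2, 1, 2, 2, 2, 2,
     0, 3, 3, 0, 3, 1, 3, 0, 2, 2, 0, 2, 1, 2, 1, 1, 3, 1, 2, 3, 2, 2, 3, 2, 1, 2, 0, 3, 1, 1, 3, 2,
     1, 0, 1, 1, 1, 2, 1, 2, 3, 1, 3, 3, 1, 3, 2, 1, 0, 1, 3, 1, 1, 1, 1, 2, 2, 1, 2, 1, 0, 2, 0, 1,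
     3, 3, 1, 1, 3, 1, 3, 1, 3, 3, 2, 1, 2, 1, 2, 1, 1, 0, 2, 3, 0, 3, 0, 3, 0, 2, 0, 1, 0, 3, 3, 2,
     1, 0, 1, 2, 1, 2, 2, 0, 2, 1, 0, 1, 1, 0, 2, 0, 1, 2, 1, 0, 3, 2, 3, 0, 3, 0, 2, 0, 1, 3])"
    by code_simp
  thus ?thesis
    unfolding compatible_def by blast
qed

lemma compatible_core_period: "compatible core period"
proof -
  have "walks False (partner core) (partner period) (List.product (reps core) (reps period)) (Some
    [2, 2, 0, 3, 2, 0, 2, 2, 0, 3, 2, 2, 1, 2, 2, 3, 2, 2, 2, 2, 0, 3, 0, 1, 2, 0, 2, 2, 0, 3, 2, 0,
     3, 0, 2, 1, 2, 2, 3, 2, 2, 3, 0, 3, 0, 2, 2, 3, 2, 3, 1, 0, 3, 0, 2, 3, 3, 3, 0, 2, 3, 2, 2, 2,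
     2, 1, 0, 2, 3, 2, 3, 3, 1, 2, 0, 1, 1, 3, 3, 2, 3, 3, 1, 0, 2, 2, 2, 2, 2, 2, 3, 0, 2, 0, 1, 3,
     2, 2, 2, 1, 1, 2, 3, 0, 3, 2, 2, 1, 2, 2, 3, 2, 3, 3, 0, 2, 1, 2, 2, 0, 2, 2, 1, 1, 1, 3, 3, 2,
     0, 3, 1, 1, 3, 1, 2, 2, 3, 0, 2, 2, 0, 2, 2, 0, 2, 1, 1, 0, 3, 0, 2, 0, 3, 0, 2, 3, 0, 1, 2, 0,
     2, 2, 1, 2, 2, 2, 2, 2, 2, 0, 1, 1, 1, 1, 0, 2, 3, 2, 1, 2, 2, 1, 2, 2, 3, 2, 3, 3, 1, 0, 2, 3,
     3, 2, 2, 3, 0, 2, 0, 2, 1, 2, 2, 2, 0, 1, 2, 2, 0, 2, 2, 0, 1, 1, 2, 3, 1, 2, 1, 1, 0, 1, 1, 0,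
     3, 3, 0, 3, 2, 2, 0, 2, 2, 1, 2, 1, 3, 1, 2, 3, 1, 2, 2, 2, 3, 1, 1, 1, 2, 2, 1, 3, 1, 3, 1, 2,
     1, 2, 1, 3, 3, 3, 2, 2, 2, 2, 0, 1, 2, 0, 2, 1, 2, 2, 0, 3, 0, 2, 0, 3, 2, 0, 3, 0, 1, 3, 1, 1,
     0, 1, 3, 1, 1, 2, 1, 1, 2, 2, 1, 1, 1, 1, 2, 2, 0, 1, 1, 1, 2, 1, 0, 2, 2, 1, 0, 1, 2, 2, 1, 2,
     3, 0, 1, 1, 1, 0, 3, 1, 1, 1, 2, 3, 2, 0, 2, 1, 1, 0, 1, 2, 1, 0, 1, 0, 1, 1, 1, 1, 1, 3, 0, 2,
     1, 1, 1, 1, 1, 3, 1, 1, 1, 2, 2, 1, 2, 1, 2, 1, 0, 1, 0, 2, 3, 2, 2, 2, 1, 0, 2, 0, 3, 2, 2, 2,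
     1, 2, 3, 0, 2, 2, 1, 3, 3, 1, 1, 2, 1, 1, 3, 3, 2, 2, 3, 0, 2, 1, 2, 0, 2, 3, 0, 3, 2, 2, 1, 3,
     2, 2, 3, 2, 0, 2, 1, 0, 2, 2, 0, 2, 1, 2, 3, 2, 1, 0, 1, 0, 1, 1, 0, 3, 2, 1, 3, 0, 2, 2, 1, 1,
     2, 3, 1, 1, 0, 1, 3, 1, 2, 2, 1, 0, 2, 1, 3, 2, 3, 2, 2, 3, 2, 0, 3, 2, 0, 3, 2, 3, 2, 2, 2, 0,
     3, 1, 3, 0, 2, 2, 0, 2, 2, 1, 3, 2, 0, 2, 1, 1, 3, 2, 1, 3, 3, 3, 2, 0, 2, 1, 2, 2, 2, 2, 0, 1,
     2, 2, 0, 2, 1, 2, 3, 0, 2, 2, 2, 3, 1, 3, 2, 0, 1, 2, 0, 3, 2, 2, 0, 3, 2, 3, 1, 3, 1, 3, 3, 2,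
     1, 1, 1, 2, 3, 1, 3, 2, 2, 2, 2, 2, 0, 3, 0, 1, 2, 0, 2, 2, 0, 3, 2, 0, 2, 3, 0, 1, 1, 1, 2, 0,
     1, 2, 3, 2, 2, 3, 2, 0, 3, 0, 2, 2, 3, 2, 3, 1, 0, 2, 1, 2, 1, 2, 3, 2, 1, 2, 3, 0, 2, 3, 2, 3,
     1, 1, 2, 2, 3, 2, 1, 2, 2, 2, 1, 2, 3, 0, 2, 2, 2, 2, 2, 2, 2, 2, 2, 3, 0, 2, 0, 3, 2, 3, 0, 3,
     2, 1, 1, 2, 1, 1, 1, 2, 3, 2, 1, 3, 1, 1, 1, 1, 2, 1, 1, 2, 0, 1, 1, 0, 2, 0, 1, 1, 1, 3, 0, 2,
     1, 3, 2, 0, 3, 0, 2, 0, 1, 3, 2, 3, 2, 2, 0, 3, 0, 3, 3, 2, 0, 3, 1, 0, 2, 2, 3, 3, 2, 0, 2, 1,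
     1, 0, 2, 1, 3, 3, 3, 2, 1, 1, 1, 1, 3, 3, 0, 3, 2, 2, 2, 2, 2, 1, 3, 2, 0, 2, 1, 3, 0, 3, 3, 0,
     3, 0, 2, 0, 2, 3, 0, 1, 1, 0, 1, 2, 0, 2, 0, 1, 1, 2, 3, 2, 2, 2, 2, 3, 2, 3, 2, 0, 3, 2, 2, 2,
     3, 0, 2, 0, 2, 1, 2, 1, 1, 1, 3, 1, 0, 2, 3, 1, 1, 1, 1, 3, 1, 1, 1, 2, 2, 2, 2, 0, 2, 3, 0, 3,
     0, 3, 0, 2, 2, 2, 1, 1, 2, 0, 2, 1, 0, 3, 2, 3, 1, 2, 2, 2, 0, 1, 2, 3, 1, 2, 3, 0, 3, 1, 2, 2,
     0, 3, 0, 2, 0, 2, 1, 2, 2, 2, 2, 0, 3, 0, 3, 2, 2, 3, 2, 3, 0, 2, 1, 2, 0, 3, 1, 3, 0, 2, 1, 2,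
     2, 0, 1, 2, 2, 2, 2, 3, 0, 3, 2, 2, 1, 2, 2, 3, 2, 2, 2, 2, 0, 3, 2, 3, 0, 3, 2, 2])"
    by code_simp
  thus ?thesis
    unfolding compatible_def by blast
qed

lemma one_edges_core: "C4_free_block core" "length (fixed_cells core) = 22"
  by code_simp+

lemma one_edges_added:
  "one_per_row tailA" "length (fixed_cells tailA) = 1"
  "one_per_row tailB" "length (fixed_cells tailB) = 2"
  "one_per_row period" "length (fixed_cells period) = 4"
  by code_simp+

lemma length_blocks: "length core = 12" "length tailA = 1" "length tailB = 2" "length period = 4"
  by code_simp+

section \<open>The values of the two numbers\<close>

text \<open>As the repeated block has four rows, up to three additional rows are needed to reach every
  residue class modulo 4.\<close>

definition remainder :: "nat \<Rightarrow> block list" where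
  "remainder j = (if j = 0 then [] else if j = 1 then [tailA] else if j = 2 then [tailB]
     else [tailA, tailB])"

definition blocks :: "nat \<Rightarrow> block list" where
  "blocks m = core # remainder ((m - 12) mod 4) @ replicate ((m - 12) div 4) period"

lemma set_blocks: "set (blocks m) \<subseteq> {core, tailA, tailB, period}"
  by (auto simp: blocks_def remainder_def)

lemma num_rows_remainder: "j < 4 \<Longrightarrow> num_rows (remainder j) = j"
  by (auto simp: remainder_def length_blocks)

lemma card_fixed_remainder: "j < 4 \<Longrightarrow> (\<Sum>t\<leftarrow>remainder j. length (fixed_cells t)) = j"
  by (auto simp: remainder_def one_edges_added)

lemma num_rows_blocks:
  assumes "m \<ge> 12"
  shows "num_rows (blocks m) = m"
proof -
  have "num_rows (blocks m) = 12 + ((m - 12) mod 4 + 4 * ((m - 12) div 4))"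
    by (simp add: blocks_def length_blocks num_rows_remainder sum_list_replicate)
  thus ?thesis using assms by simp
qed

lemma card_ones_blocks:
  assumes "m \<ge> 12"
  shows "card (ones (blocks m)) = m + 10"
proof -
  have "[] \<notin> set (blocks m)"
  proof
    assume "[] \<in> set (blocks m)"
    hence "[] \<in> {core, tailA, tailB, period}"
      using set_blocks by blast
    hence "length ([] :: block) \<in> length ` {core, tailA, tailB, period}"
      by (rule imageI)
    thus False
      by (simp add: length_blocks)
  qed
  hence "card (ones (blocks m)) = 22 + ((m - 12) mod 4 + 4 * ((m - 12) div 4))"
    by (simp add: card_ones blocks_def one_edges_core one_edges_added card_fixed_remainder
        sum_list_replicate)
  thus ?thesis using assms by simp
qed

lemma closed_blocks: "\<forall>t\<in>set (blocks m). closed_block t"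
  using set_blocks[of m] closed_core closed_tailA closed_tailB closed_period by blast

lemma sorted_wrt_replicate: "P x x \<Longrightarrow> sorted_wrt P (replicate k x)"
  by (induction k) auto

lemma compatible_blocks: "sorted_wrt compatible (blocks m)"
  unfolding blocks_def remainder_def
  by (auto simp: sorted_wrt_append sorted_wrt_replicate compatible_core_tailA compatible_core_tailB
      compatible_core_period compatible_tailA_tailB compatible_tailA_period
      compatible_tailB_period compatible_period_period)

lemma C4_free_blocks: "C4_free (ones (blocks m))"
  unfolding blocks_def
  by (rule C4_free_ones[OF one_edges_core(1)]) (auto simp: remainder_def one_edges_added)

lemma zarankiewicz_5:
  assumes "m \<ge> 12"
  shows "zarankiewicz m 5 = m + 10"
proof -
  have [simp]: "5 choose 2 = (10 :: nat)"
    by (simp add: choose_two)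
  interpret block_layout "blocks m"
    using closed_blocks C4_free_blocks by unfold_locales (auto simp: closed_block_def)
  have "zarankiewicz m 5 = m + (5 choose 2)"
    using simple_configD(1)[OF simple] C4_free_blocks card_ones_blocks[OF assms]
    unfolding num_rows_blocks[OF assms] by (intro zarankiewicz_eqI) auto
  thus ?thesis by simp
qed

text \<open>The number of edge elements is \<open>card E1 = m + 10\<close> plus half of the number of occupied cells among
  the \<open>4 m - 10\<close> others, so that two holes cost one edge element.\<close>

lemma limited_config_count:
  assumes "m \<ge> 12" "simple_config m 5 E1 E2" "limited m 5 E1"
  shows "2 * (card E1 + card E2) + holes m 5 E1 E2 = 6 * m + 10"
  using cell_count[OF assms(2)] assms(3) zarankiewicz_5[OF assms(1)] by (simp add: limited_def)

text \<open>The stack of blocks has no holes, so that the count is exact.\<close>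

lemma extremal_config:
  assumes m: "m \<ge> 12"
  obtains E1 E2 where "simple_config m 5 E1 E2" "limited m 5 E1" "RW3plus m 5 E1 E2"
    "card E1 + card E2 = 3 * m + 5"
proof -
  interpret block_layout "blocks m"
    using closed_blocks C4_free_blocks by unfold_locales (auto simp: closed_block_def)
  let ?E1 = "ones (blocks m)" and ?E2 = "twos (blocks m)"
  have sc: "simple_config m 5 ?E1 ?E2"
    using simple num_rows_blocks[OF m] by simp
  moreover have lim: "limited m 5 ?E1"
    by (simp add: limited_def card_ones_blocks[OF m] zarankiewicz_5[OF m])
  moreover have "RW3plus m 5 ?E1 ?E2"
    using RW3plus_layout[OF closed_blocks compatible_blocks] num_rows_blocks[OF m] by simp
  moreover have "holes m 5 ?E1 ?E2 = 0"
    using full num_rows_blocks[OF m] by (simp add: holes_def)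
  hence "card ?E1 + card ?E2 = 3 * m + 5"
    using limited_config_count[OF m sc lim] by simp
  ultimately show thesis by (rule that)
qed

lemma z_values:
  assumes "m \<ge> 12"
  shows "z_RL m 5 = 3 * m + 5" "z2 m 5 = 3 * m + 5"
proof -
  have le: "card E1 + card E2 \<le> 3 * m + 5" if "simple_config m 5 E1 E2" "limited m 5 E1" for E1 E2
    using limited_config_count[OF assms that] by simp
  obtain E1 E2 where E: "simple_config m 5 E1 E2" "limited m 5 E1" "RW3plus m 5 E1 E2"
    "card E1 + card E2 = 3 * m + 5"
    using extremal_config[OF assms] .
  show "z_RL m 5 = 3 * m + 5"
    unfolding z_RL_def
  proof (rule Max_attained)
    show "3 * m + 5 \<in> {card E1 + card E2 |E1 E2.
        simple_config m 5 E1 E2 \<and> limited m 5 E1 \<and> RW3plus m 5 E1 E2}"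
      using E(1-3) E(4)[symmetric] by blast
  qed (use le in blast)
  show "z2 m 5 = 3 * m + 5"
    unfolding z2_def
  proof (rule Max_attained)
    show "3 * m + 5 \<in> {card E1 + card E2 |E1 E2.
        simple_config m 5 E1 E2 \<and> limited m 5 E1 \<and> irreducible_config m 5 E1 E2}"
      using E(1,2) RW3plus_imp_irreducible[OF E(1,3)] E(4)[symmetric] by blast
  qed (use le in blast)
qed

theorem corollary5p5:
  fixes m :: nat
  assumes "m \<ge> 12"
  shows "z2 m 5 = z_RL m 5 \<and> z_RL m 5 = 3 * m + 5 \<and>
    (\<forall>E1 E2. simple_config m 5 E1 E2 \<and> limited m 5 E1 \<and> RW3plus m 5 E1 E2 \<and>
       card E1 + card E2 = z_RL m 5 \<longrightarrow> holes m 5 E1 E2 = 0) \<and>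
    z_RL (m + 1) 5 = z_RL m 5 + 3"
proof (intro conjI allI impI)
  fix E1 E2
  assume "simple_config m 5 E1 E2 \<and> limited m 5 E1 \<and> RW3plus m 5 E1 E2 \<and>
    card E1 + card E2 = z_RL m 5"
  thus "holes m 5 E1 E2 = 0"
    using limited_config_count[OF assms, of E1 E2] z_values(1)[OF assms] by simp
qed (use z_values[OF assms] z_values[of "m + 1"] assms in simp_all)

end
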